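(* Let $k$ be an algebraically closed field and let $f:\mathbb{P}^1\to\mathbb{P}^1$ be a surjective morphism over $k$ of degree $n$. Then the direct image of the trivial line bundle is given by $$f_*\mathcal{O}\cong\mathcal{O}\oplus\mathcal{O}(-1)^{\oplus(n-1)}.$$
   Context: $\mathbb{P}^1$ is the projective line over $k$, $\mathcal{O}$ is the trivial line bundle on $\mathbb{P}^1$, and $\mathcal{O}(-1)$ is the tautological line bundle on $\mathbb{P}^1$. *)

theory Defs
  imports
    "HOL-Computational_Algebra.Polynomial"
    "HOL-Library.FuncSet"
    "HOL-Algebra.Module"
    "HOL-Algebra.Embedded_Algebras"
begin

section \<open>The projective line as a variety\<close>

text \<open>
  The ground field is algebraically closed in the main theorem, so \<open>P\<^sup>1\<close> is treated as a
  classical variety: its points are the lines through the origin of \<open>k\<^sup>2\<close>, with the Zariski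
  topology and the sheaf of regular functions.
\<close>

definition line_through :: "'k::field \<times> 'k \<Rightarrow> ('k \<times> 'k) set" where
  "line_through v = range (\<lambda>c. (c * fst v, c * snd v))"

typedef (overloaded) 'k proj_line =
  "{L :: ('k::field \<times> 'k) set. \<exists>v. v \<noteq> (0, 0) \<and> L = line_through v}"
  morphisms line_of Abs_proj_line
  by (auto intro!: exI[of _ 1])

definition forms :: "nat \<Rightarrow> ('k::field \<times> 'k \<Rightarrow> 'k) set" where
  "forms d = {F. \<exists>a. F = (\<lambda>(x, y). \<Sum>i\<le>d. a i * x ^ i * y ^ (d - i))}"

definition vanishes_at :: "('k::field \<times> 'k \<Rightarrow> 'k) \<Rightarrow> 'k proj_line \<Rightarrow> bool" where
  "vanishes_at F p \<longleftrightarrow> (\<forall>v \<in> line_of p. F v = 0)"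

definition zero_locus :: "('k::field \<times> 'k \<Rightarrow> 'k) set \<Rightarrow> 'k proj_line set" where
  "zero_locus T = {p. \<forall>F \<in> T. vanishes_at F p}"

lemma form_scale:
  assumes "F \<in> forms d"
  shows "F (c * x, c * y) = c ^ d * F (x, y)"
proof -
  obtain a where F: "F = (\<lambda>(x, y). \<Sum>i\<le>d. a i * x ^ i * y ^ (d - i))"
    using assms by (auto simp: forms_def)
  have "a i * (c * x) ^ i * (c * y) ^ (d - i) = c ^ d * (a i * x ^ i * y ^ (d - i))"
    if "i \<le> d" for i
  proof -
    have "c ^ d = c ^ i * c ^ (d - i)" using that by (simp flip: power_add)
    then show ?thesis by (simp add: power_mult_distrib)
  qed
  then show ?thesis unfolding F by (simp only: prod.case sum_distrib_left) (rule sum.cong, simp_all only: atMost_iff)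
qed

lemma form_mult:
  assumes "F \<in> forms d" "G \<in> forms e"
  shows "(\<lambda>v. F v * G v) \<in> forms (d + e)"
proof -
  obtain a where F: "F = (\<lambda>(x, y). \<Sum>i\<le>d. a i * x ^ i * y ^ (d - i))"
    using assms by (auto simp: forms_def)
  obtain b where G: "G = (\<lambda>(x, y). \<Sum>j\<le>e. b j * x ^ j * y ^ (e - j))"
    using assms by (auto simp: forms_def)
  define c where "c n = (\<Sum>(i, j) | i \<le> d \<and> j \<le> e \<and> i + j = n. a i * b j)" for n
  have "F (x, y) * G (x, y) = (\<Sum>n\<le>d + e. c n * x ^ n * y ^ (d + e - n))" for x y
  proof -
    have "(\<Sum>n\<le>d + e. c n * x ^ n * y ^ (d + e - n)) =
        (\<Sum>n\<le>d + e. \<Sum>p | p \<in> {..d} \<times> {..e} \<and> fst p + snd p = n.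
           (a (fst p) * x ^ fst p * y ^ (d - fst p)) * (b (snd p) * x ^ snd p * y ^ (e - snd p)))"
    proof (rule sum.cong[OF refl])
      fix n assume "n \<in> {..d + e}"
      have S: "{(i, j). i \<le> d \<and> j \<le> e \<and> i + j = n} =
          {p. p \<in> {..d} \<times> {..e} \<and> fst p + snd p = n}" by auto
      show "c n * x ^ n * y ^ (d + e - n) = (\<Sum>p | p \<in> {..d} \<times> {..e} \<and> fst p + snd p = n.
           (a (fst p) * x ^ fst p * y ^ (d - fst p)) * (b (snd p) * x ^ snd p * y ^ (e - snd p)))"
        unfolding c_def S sum_distrib_right
      proof (rule sum.cong[OF refl])
        fix p assume p: "p \<in> {p. p \<in> {..d} \<times> {..e} \<and> fst p + snd p = n}"
        obtain i j where ij: "p = (i, j)" by (cases p)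
        have le: "i \<le> d" "j \<le> e" and n: "n = i + j" using p by (auto simp: ij)
        have "d + e - n = (d - i) + (e - j)" using le n by simp
        then show "(case p of (i, j) \<Rightarrow> a i * b j) * x ^ n * y ^ (d + e - n) =
          (a (fst p) * x ^ fst p * y ^ (d - fst p)) * (b (snd p) * x ^ snd p * y ^ (e - snd p))"
          by (simp add: ij n power_add mult_ac)
      qed
    qed
    also have "\<dots> = (\<Sum>p\<in>{..d} \<times> {..e}.
           (a (fst p) * x ^ fst p * y ^ (d - fst p)) * (b (snd p) * x ^ snd p * y ^ (e - snd p)))"
      by (rule sum.group) auto
    also have "\<dots> = F (x, y) * G (x, y)"
      by (simp add: F G sum_product sum.cartesian_product case_prod_unfold)
    finally show ?thesis by simp
  qed
  then show ?thesis unfolding forms_def by (auto intro!: exI[of _ c])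
qed

lemma vanishes_at_iff:
  assumes "F \<in> forms d" "line_of p = line_through v"
  shows "vanishes_at F p \<longleftrightarrow> F v = 0"
proof
  assume "vanishes_at F p"
  moreover have "v \<in> line_of p"
    unfolding assms(2) line_through_def by (rule range_eqI[of _ _ 1]) simp
  ultimately show "F v = 0" by (simp add: vanishes_at_def)
next
  assume "F v = 0"
  then show "vanishes_at F p"
    using form_scale[OF assms(1), of _ "fst v" "snd v"]
    by (auto simp: vanishes_at_def assms(2) line_through_def)
qed

instantiation proj_line :: (field) topological_space
begin

definition open_proj_line :: "'a proj_line set \<Rightarrow> bool" where
  "open_proj_line U \<longleftrightarrow> (\<exists>T \<subseteq> (\<Union>d. forms d). - U = zero_locus T)"

instance
proof
  have "(\<lambda>_. 1 :: 'a) \<in> forms 0" by (auto simp: forms_def intro!: exI[of _ "\<lambda>_. 1"])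
  then have "{\<lambda>_. 1 :: 'a} \<subseteq> (\<Union>d. forms d)" by blast
  moreover have "\<not> vanishes_at (\<lambda>_. 1) p" for p :: "'a proj_line"
  proof -
    obtain v where "line_of p = line_through v" using line_of[of p] by blast
    then have "v \<in> line_of p"
      unfolding line_through_def by (simp add: range_eqI[of _ _ 1])
    then show ?thesis unfolding vanishes_at_def using one_neq_zero by blast
  qed
  then have "zero_locus {\<lambda>_. 1 :: 'a} = {}" by (simp add: zero_locus_def)
  ultimately show "open (UNIV :: 'a proj_line set)"
    unfolding open_proj_line_def by (metis Compl_UNIV_eq)
next
  fix U V :: "'a proj_line set"
  assume "open U" "open V"
  then obtain S T where S: "S \<subseteq> (\<Union>d. forms d)" "- U = zero_locus S"
    and T: "T \<subseteq> (\<Union>d. forms d)" "- V = zero_locus T"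
    unfolding open_proj_line_def by metis
  define R where "R = {\<lambda>v. F v * G v | F G. F \<in> S \<and> G \<in> T}"
  have R: "R \<subseteq> (\<Union>d. forms d)"
  proof
    fix H assume "H \<in> R"
    then obtain F G where FG: "F \<in> S" "G \<in> T" "H = (\<lambda>v. F v * G v)"
      unfolding R_def by blast
    then obtain d e where "F \<in> forms d" "G \<in> forms e" using S(1) T(1) by blast
    then show "H \<in> (\<Union>d. forms d)" using form_mult[of F d G e] FG(3) by blast
  qed
  have mult: "vanishes_at (\<lambda>v. F v * G v) p \<longleftrightarrow> vanishes_at F p \<or> vanishes_at G p"
    if FG: "F \<in> S" "G \<in> T" for F G p
  proof -
    obtain d e where de: "F \<in> forms d" "G \<in> forms e" using S(1) T(1) FG by blast
    obtain v where v: "line_of p = line_through v" using line_of[of p] by auto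
    show ?thesis
      using vanishes_at_iff[OF de(1) v] vanishes_at_iff[OF de(2) v]
        vanishes_at_iff[OF form_mult[OF de] v] by simp
  qed
  have "vanishes_at H p" if H: "H \<in> R" and p: "p \<in> zero_locus S \<union> zero_locus T" for H p
  proof -
    obtain F G where FG: "F \<in> S" "G \<in> T" "H = (\<lambda>v. F v * G v)"
      using H unfolding R_def by blast
    have "vanishes_at F p \<or> vanishes_at G p"
      using p FG(1,2) unfolding zero_locus_def by blast
    then show ?thesis unfolding FG(3) using mult[OF FG(1,2)] by blast
  qed
  moreover have "p \<in> zero_locus S" if p: "p \<in> zero_locus R" "p \<notin> zero_locus T" for p
  proof -
    obtain G where G: "G \<in> T" "\<not> vanishes_at G p" using p(2) by (auto simp: zero_locus_def)
    have "vanishes_at F p" if "F \<in> S" for F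
    proof -
      have "(\<lambda>v. F v * G v) \<in> R"
        using that G(1) unfolding R_def by blast
      then show ?thesis using p(1) mult[OF that G(1)] G(2) by (auto simp: zero_locus_def)
    qed
    then show ?thesis by (simp add: zero_locus_def)
  qed
  ultimately have "zero_locus R = zero_locus S \<union> zero_locus T"
    unfolding zero_locus_def by blast
  then have "- (U \<inter> V) = zero_locus R" using S T by blast
  then show "open (U \<inter> V)" unfolding open_proj_line_def using R by blast
next
  fix \<U> :: "'a proj_line set set"
  assume "\<forall>U\<in>\<U>. open U"
  then obtain T where T: "T U \<subseteq> (\<Union>d. forms d)" "- U = zero_locus (T U)" if "U \<in> \<U>" for U
    unfolding open_proj_line_def by metis
  have "- \<Union>\<U> = zero_locus (\<Union>U\<in>\<U>. T U)"
    using T(2) by (fastforce simp: zero_locus_def)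
  moreover have "(\<Union>U\<in>\<U>. T U) \<subseteq> (\<Union>d. forms d)" using T(1) by blast
  ultimately show "open (\<Union>\<U>)" unfolding open_proj_line_def by metis
qed

end

text \<open>Sections over \<open>U\<close> are functions on \<open>U\<close>, encoded as functions that are
  \<^const>\<open>undefined\<close> outside \<open>U\<close>.\<close>

definition regular_on :: "'k::field proj_line set \<Rightarrow> ('k proj_line \<Rightarrow> 'k) \<Rightarrow> bool" where
  "regular_on U s \<longleftrightarrow>
     (\<forall>p \<in> U. \<exists>W d F G. open W \<and> p \<in> W \<and> W \<subseteq> U \<and> F \<in> forms d \<and> G \<in> forms d \<and>
        (\<forall>q \<in> W. \<forall>v \<in> line_of q. v \<noteq> (0, 0) \<longrightarrow> G v \<noteq> 0 \<and> s q = F v / G v))"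

definition regular_functions :: "'k::field proj_line set \<Rightarrow> ('k proj_line \<Rightarrow> 'k) ring" where
  "regular_functions U =
     \<lparr>carrier = {s \<in> extensional U. regular_on U s},
      monoid.mult = (\<lambda>s t. \<lambda>p\<in>U. s p * t p),
      one = (\<lambda>p\<in>U. 1),
      zero = (\<lambda>p\<in>U. 0),
      add = (\<lambda>s t. \<lambda>p\<in>U. s p + t p)\<rparr>"


section \<open>Morphisms and their degree\<close>

definition pullback ::
    "('k::field proj_line \<Rightarrow> 'k proj_line) \<Rightarrow> 'k proj_line set \<Rightarrow> ('k proj_line \<Rightarrow> 'k)
      \<Rightarrow> ('k proj_line \<Rightarrow> 'k)" where
  "pullback f U s = (\<lambda>p \<in> f -` U. s (f p))"

definition morphism :: "('k::field proj_line \<Rightarrow> 'k proj_line) \<Rightarrow> bool" where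
  "morphism f \<longleftrightarrow> continuous_on UNIV f \<and>
     (\<forall>U. open U \<longrightarrow> (\<forall>s \<in> carrier (regular_functions U).
        pullback f U s \<in> carrier (regular_functions (f -` U))))"

text \<open>A rational function is a class of pairs \<open>(U, s)\<close> with \<open>s\<close> regular on the nonempty open
  set \<open>U\<close>, two pairs being identified if they agree on the intersection of the open sets.\<close>

definition rat_class ::
    "'k::field proj_line set \<Rightarrow> ('k proj_line \<Rightarrow> 'k) \<Rightarrow> ('k proj_line set \<times> ('k proj_line \<Rightarrow> 'k)) set"
  where
  "rat_class U s = {(V, t). open V \<and> V \<noteq> {} \<and> t \<in> carrier (regular_functions V) \<and>
     (\<forall>p \<in> U \<inter> V. s p = t p)}"

definition function_field :: "('k::field proj_line set \<times> ('k proj_line \<Rightarrow> 'k)) set ring" where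
  "function_field =
     \<lparr>carrier = {rat_class U s | U s. open U \<and> U \<noteq> {} \<and> s \<in> carrier (regular_functions U)},
      monoid.mult = (\<lambda>A B. \<Union>(U, s) \<in> A. \<Union>(V, t) \<in> B. rat_class (U \<inter> V) (\<lambda>p \<in> U \<inter> V. s p * t p)),
      one = rat_class UNIV (\<lambda>_. 1),
      zero = rat_class UNIV (\<lambda>_. 0),
      add = (\<lambda>A B. \<Union>(U, s) \<in> A. \<Union>(V, t) \<in> B. rat_class (U \<inter> V) (\<lambda>p \<in> U \<inter> V. s p + t p))\<rparr>"

definition function_field_pullback ::
    "('k::field proj_line \<Rightarrow> 'k proj_line) \<Rightarrow> ('k proj_line set \<times> ('k proj_line \<Rightarrow> 'k)) set
      \<Rightarrow> ('k proj_line set \<times> ('k proj_line \<Rightarrow> 'k)) set" where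
  "function_field_pullback f A = (\<Union>(U, s) \<in> A. rat_class (f -` U) (pullback f U s))"

text \<open>The degree of a dominant morphism is the degree of the extension of function fields
  induced by pullback; inseparable extensions are allowed.\<close>

definition has_degree :: "('k::field proj_line \<Rightarrow> 'k proj_line) \<Rightarrow> nat \<Rightarrow> bool" where
  "has_degree f n \<longleftrightarrow>
     ring.dimension function_field n
       (function_field_pullback f ` carrier function_field) (carrier function_field)"


section \<open>Sheaves of modules over the structure sheaf\<close>

text \<open>A sheaf of modules is given by its modules of sections over the open sets and
  its restriction maps; \<open>restr M U V\<close> goes from sections over \<open>U\<close> to sections over \<open>V \<subseteq> U\<close>.
  The ring multiplication and unit of the module records play no role.\<close>

record ('p, 'a, 'm) sheaf_data =
  sections :: "'p set \<Rightarrow> ('a, 'm) module"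
  restr :: "'p set \<Rightarrow> 'p set \<Rightarrow> 'm \<Rightarrow> 'm"

type_synonym ('k, 'm) module_sheaf = "('k proj_line, 'k proj_line \<Rightarrow> 'k, 'm) sheaf_data"

definition module_sheaf_iso ::
    "('k::field, 'm) module_sheaf \<Rightarrow> ('k, 'n) module_sheaf \<Rightarrow> bool" (infix \<open>\<cong>\<^sub>O\<close> 50) where
  "M \<cong>\<^sub>O N \<longleftrightarrow> (\<exists>\<phi> :: 'k proj_line set \<Rightarrow> 'm \<Rightarrow> 'n.
     (\<forall>U. open U \<longrightarrow>
        bij_betw (\<phi> U) (carrier (sections M U)) (carrier (sections N U)) \<and>
        (\<forall>x \<in> carrier (sections M U). \<forall>y \<in> carrier (sections M U).
           \<phi> U (x \<oplus>\<^bsub>sections M U\<^esub> y) = \<phi> U x \<oplus>\<^bsub>sections N U\<^esub> \<phi> U y) \<and>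
        (\<forall>a \<in> carrier (regular_functions U). \<forall>x \<in> carrier (sections M U).
           \<phi> U (a \<odot>\<^bsub>sections M U\<^esub> x) = a \<odot>\<^bsub>sections N U\<^esub> \<phi> U x)) \<and>
     (\<forall>U V. open U \<longrightarrow> open V \<longrightarrow> V \<subseteq> U \<longrightarrow>
        (\<forall>x \<in> carrier (sections M U). \<phi> V (restr M U V x) = restr N U V (\<phi> U x))))"

definition trivial_line_bundle :: "('k::field, 'k proj_line \<Rightarrow> 'k) module_sheaf" (\<open>\<O>\<close>) where
  "\<O> = \<lparr>sections = (\<lambda>U.
         \<lparr>carrier = carrier (regular_functions U),
          monoid.mult = undefined, one = undefined,
          zero = \<zero>\<^bsub>regular_functions U\<^esub>,
          add = add (regular_functions U),
          smult = monoid.mult (regular_functions U)\<rparr>),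
       restr = (\<lambda>U V s. restrict s V)\<rparr>"

text \<open>The tautological bundle is the subbundle of \<open>P\<^sup>1 \<times> k\<^sup>2\<close> whose fibre over a point is the
  line which that point represents.\<close>

definition tautological_line_bundle ::
    "('k::field, 'k proj_line \<Rightarrow> 'k \<times> 'k) module_sheaf" (\<open>\<O>'(-1')\<close>) where
  "\<O>(-1) = \<lparr>sections = (\<lambda>U.
         \<lparr>carrier = {\<sigma> \<in> extensional U. regular_on U (\<lambda>p. fst (\<sigma> p)) \<and>
             regular_on U (\<lambda>p. snd (\<sigma> p)) \<and> (\<forall>p \<in> U. \<sigma> p \<in> line_of p)},
          monoid.mult = undefined, one = undefined,
          zero = (\<lambda>p\<in>U. (0, 0)),
          add = (\<lambda>\<sigma> \<tau>. \<lambda>p\<in>U. (fst (\<sigma> p) + fst (\<tau> p), snd (\<sigma> p) + snd (\<tau> p))),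
          smult = (\<lambda>a \<sigma>. \<lambda>p\<in>U. (a p * fst (\<sigma> p), a p * snd (\<sigma> p)))\<rparr>),
       restr = (\<lambda>U V \<sigma>. restrict \<sigma> V)\<rparr>"

definition direct_sum ::
    "('k::field, 'm) module_sheaf \<Rightarrow> ('k, 'n) module_sheaf \<Rightarrow> ('k, 'm \<times> 'n) module_sheaf"
    (infixr \<open>\<oplus>\<^sub>O\<close> 65) where
  "M \<oplus>\<^sub>O N = \<lparr>sections = (\<lambda>U.
         \<lparr>carrier = carrier (sections M U) \<times> carrier (sections N U),
          monoid.mult = undefined, one = undefined,
          zero = (\<zero>\<^bsub>sections M U\<^esub>, \<zero>\<^bsub>sections N U\<^esub>),
          add = (\<lambda>(x, y) (x', y'). (x \<oplus>\<^bsub>sections M U\<^esub> x', y \<oplus>\<^bsub>sections N U\<^esub> y')),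
          smult = (\<lambda>a (x, y). (a \<odot>\<^bsub>sections M U\<^esub> x, a \<odot>\<^bsub>sections N U\<^esub> y))\<rparr>),
       restr = (\<lambda>U V (x, y). (restr M U V x, restr N U V y))\<rparr>"

definition direct_power ::
    "('k::field, 'm) module_sheaf \<Rightarrow> nat \<Rightarrow> ('k, nat \<Rightarrow> 'm) module_sheaf"
    (infixr \<open>^\<^sub>O\<close> 80) where
  "M ^\<^sub>O r = \<lparr>sections = (\<lambda>U.
         \<lparr>carrier = {..<r} \<rightarrow>\<^sub>E carrier (sections M U),
          monoid.mult = undefined, one = undefined,
          zero = (\<lambda>i\<in>{..<r}. \<zero>\<^bsub>sections M U\<^esub>),
          add = (\<lambda>x y. \<lambda>i\<in>{..<r}. x i \<oplus>\<^bsub>sections M U\<^esub> y i),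
          smult = (\<lambda>a x. \<lambda>i\<in>{..<r}. a \<odot>\<^bsub>sections M U\<^esub> x i)\<rparr>),
       restr = (\<lambda>U V x. \<lambda>i\<in>{..<r}. restr M U V (x i))\<rparr>"

definition direct_image ::
    "('k::field proj_line \<Rightarrow> 'k proj_line) \<Rightarrow> ('k, 'm) module_sheaf \<Rightarrow> ('k, 'm) module_sheaf" where
  "direct_image f M = \<lparr>sections = (\<lambda>U. sections M (f -` U)
          \<lparr>smult := (\<lambda>a x. pullback f U a \<odot>\<^bsub>sections M (f -` U)\<^esub> x)\<rparr>),
       restr = (\<lambda>U V. restr M (f -` U) (f -` V))\<rparr>"

end

theory Submission
  imports Defs
begin

text \<open>In homogeneous coordinates \<open>f = [P : Q]\<close> for forms \<open>P\<close>, \<open>Q\<close> of one degree \<open>d > 0\<close> without common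
  zeros. Complete \<open>P\<close>, \<open>Q\<close> to a basis \<open>P, Q, G\<^sub>1, \<dots>, G\<^bsub>d-1\<^esub>\<close> of the forms of degree \<open>d\<close>. Every form of degree
  at least \<open>2d - 1\<close> lies in the ideal \<open>(P, Q)\<close>, so every form of degree \<open>md\<close> is uniquely
  \<open>R(P, Q) + \<Sum> S\<^sub>i(P, Q) G\<^sub>i\<close> with \<open>R\<close> of degree \<open>m\<close> and \<open>S\<^sub>i\<close> of degree \<open>m - 1\<close>. A regular function on
  \<open>f\<^sup>-\<^sup>1(U)\<close> can be written with a denominator \<open>H(P, Q)\<close>, where \<open>H\<close> has no zero on \<open>U\<close>; dividing by it
  exhibits \<open>f\<^sub>*\<O>\<close> as \<open>\<O> \<oplus> \<O>(-1)\<^bsup>d-1\<^esup>\<close>, a section \<open>w \<mapsto> c w\<close> of the tautological bundle in place \<open>i\<close>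
  contributing \<open>c G\<^sub>i\<close>. The same decomposition shows that \<open>1, G\<^sub>1/Q, \<dots>, G\<^bsub>d-1\<^esub>/Q\<close> is a basis of the
  extension of function fields, so \<open>d\<close> is the degree.\<close>

section \<open>Forms\<close>

text \<open>The twist by -1 comes from degrees. With a denominator \<open>H\<close> of degree
  \<open>m\<close>, the coefficient \<open>S\<^sub>i / H\<close> is homogeneous of degree -1 in the
  vector \<open>w\<close> of the target, so it is not a function of the line through
  \<open>w\<close>; but the vector \<open>(S\<^sub>i(w) / H(w)) w\<close> depends only on that line
  and lies on it. The main obstacle is the denominator: a regular function on a preimage comes with
  a denominator \<open>B\<close> on the source, which must be completed to a form in
  \<open>P\<close> and \<open>Q\<close> without creating zeros over \<open>U\<close>. Forms are
  functions here, not polynomials. Identities between them are therefore tested at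
  \<open>(t, 1)\<close> for all but finitely many \<open>t\<close>, and the same device decides
  equality of rational functions. The degree is found from a basis rather than from the number of
  points in a fibre, so inseparable morphisms need no separate treatment.\<close>

lemma forms_iff_poly:
  "F \<in> forms d \<longleftrightarrow>
    (\<exists>p. degree p \<le> d \<and> F = (\<lambda>(x, y). \<Sum>i\<le>d. poly.coeff p i * x ^ i * y ^ (d - i)))"
proof
  assume "F \<in> forms d"
  then obtain a where F: "F = (\<lambda>(x, y). \<Sum>i\<le>d. a i * x ^ i * y ^ (d - i))"
    by (auto simp: forms_def)
  define p where "p = (\<Sum>i\<le>d. Polynomial.monom (a i) i)"
  have c: "poly.coeff p i = (if i \<le> d then a i else 0)" for i
    by (simp add: p_def coeff_sum)
  then have "degree p \<le> d" by (intro degree_le) auto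
  moreover have "F = (\<lambda>(x, y). \<Sum>i\<le>d. poly.coeff p i * x ^ i * y ^ (d - i))"
    unfolding F c by (intro ext) (auto intro!: sum.cong)
  ultimately show "\<exists>p. degree p \<le> d \<and> F = (\<lambda>(x, y). \<Sum>i\<le>d. poly.coeff p i * x ^ i * y ^ (d - i))"
    by blast
qed (auto simp: forms_def)

text \<open>Dehomogenisation. The degree of a nonzero \<open>p\<close> may be smaller than
  \<open>d\<close>; the difference is the order of the zero at \<open>(1, 0)\<close>, which the
  affine coordinate does not see.\<close>

lemma form_affine:
  fixes F :: "'k::field \<times> 'k \<Rightarrow> 'k"
  assumes "F = (\<lambda>(x, y). \<Sum>i\<le>d. poly.coeff p i * x ^ i * y ^ (d - i))" "degree p \<le> d"
  shows "F (t, 1) = poly p t"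
proof -
  have "(\<Sum>i\<le>d. poly.coeff p i * t ^ i) = (\<Sum>i\<le>degree p. poly.coeff p i * t ^ i)"
    using assms(2) by (intro sum.mono_neutral_right) (auto simp: coeff_eq_0)
  then show ?thesis by (simp add: assms(1) poly_altdef)
qed

lemma form_zero: "(\<lambda>_. 0) \<in> forms d"
  unfolding forms_def by (auto intro!: exI[of _ "\<lambda>_. 0"])

lemma form_const: "(\<lambda>_. c) \<in> forms 0"
  unfolding forms_def by (auto intro!: exI[of _ "\<lambda>_. c"])

lemma form_0E:
  assumes "F \<in> forms 0"
  obtains c where "F = (\<lambda>_. c)"
proof -
  obtain a where "F = (\<lambda>_. a (0::nat))" using assms by (auto simp: forms_def case_prod_unfold)
  then show ?thesis by (rule that)
qed

lemma form_add:
  assumes "F \<in> forms d" "G \<in> forms d"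
  shows "(\<lambda>v. F v + G v) \<in> forms d"
proof -
  obtain a b where "F = (\<lambda>(x, y). \<Sum>i\<le>d. a i * x ^ i * y ^ (d - i))"
    "G = (\<lambda>(x, y). \<Sum>i\<le>d. b i * x ^ i * y ^ (d - i))"
    using assms by (auto simp: forms_def)
  then show ?thesis
    by (auto simp: forms_def fun_eq_iff algebra_simps sum.distrib intro!: exI[of _ "\<lambda>i. a i + b i"])
qed

lemma form_cmult: "F \<in> forms d \<Longrightarrow> (\<lambda>v. c * F v) \<in> forms d"
  using form_mult[OF form_const] by fastforce

lemma form_diff:
  assumes "F \<in> forms d" "G \<in> forms d"
  shows "(\<lambda>v. F v - G v) \<in> forms d"
  using form_add[OF assms(1) form_cmult[OF assms(2), of "-1"]] by simp

lemma form_sum: "(\<And>i. i \<in> I \<Longrightarrow> F i \<in> forms d) \<Longrightarrow> (\<lambda>v. \<Sum>i\<in>I. F i v) \<in> forms d"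
  by (induction I rule: infinite_finite_induct) (auto simp: form_zero form_add)

lemma form_fst: "fst \<in> forms 1"
  unfolding forms_def by (auto simp: fun_eq_iff intro!: exI[of _ "\<lambda>i. if i = 1 then 1 else 0"])

lemma form_snd: "snd \<in> forms 1"
  unfolding forms_def by (auto simp: fun_eq_iff intro!: exI[of _ "\<lambda>i. if i = 0 then 1 else 0"])

lemma form_linear: "(\<lambda>v. b * fst v - a * snd v) \<in> forms 1"
  by (intro form_diff form_cmult form_fst form_snd)

lemma form_power: "F \<in> forms d \<Longrightarrow> (\<lambda>v. F v ^ n) \<in> forms (n * d)"
  by (induction n) (auto intro: form_const form_mult)

lemma form_monomial: "i \<le> d \<Longrightarrow> (\<lambda>v. fst v ^ i * snd v ^ (d - i)) \<in> forms d"
  using form_mult[OF form_power[OF form_fst, of i] form_power[OF form_snd, of "d - i"]] by simp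

lemma form_compose:
  assumes "F \<in> forms m" "P \<in> forms d" "Q \<in> forms d"
  shows "(\<lambda>v. F (P v, Q v)) \<in> forms (m * d)"
proof -
  obtain a where F: "F = (\<lambda>(x, y). \<Sum>i\<le>m. a i * x ^ i * y ^ (m - i))"
    using assms by (auto simp: forms_def)
  have "(\<lambda>v. a i * (P v ^ i * Q v ^ (m - i))) \<in> forms (m * d)" if "i \<le> m" for i
    using form_cmult[OF form_mult[OF form_power[OF assms(2)] form_power[OF assms(3)]], of "a i" i "m - i"]
      that by (simp flip: add_mult_distrib)
  then show ?thesis unfolding F by (auto simp: mult.assoc intro!: form_sum)
qed

text \<open>Separates the one monomial not divisible by the first coordinate. After substituting
  \<open>(P, Q)\<close> it isolates the part not visibly divisible by \<open>P\<close>, a multiple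
  of a power of \<open>Q\<close>; this drives the induction in
  \<open>forms_independent\<close>.\<close>

lemma form_Suc_split:
  assumes "F \<in> forms (Suc d)"
  obtains F' c where "F' \<in> forms d" "F = (\<lambda>v. fst v * F' v + c * snd v ^ Suc d)"
proof -
  obtain a where F: "F = (\<lambda>(x, y). \<Sum>i\<le>Suc d. a i * x ^ i * y ^ (Suc d - i))"
    using assms by (auto simp: forms_def)
  define F' where "F' = (\<lambda>(x, y). \<Sum>i\<le>d. a (Suc i) * x ^ i * y ^ (d - i))"
  have "F' \<in> forms d" unfolding F'_def forms_def by (auto intro!: exI[of _ "\<lambda>i. a (Suc i)"])
  moreover have "F = (\<lambda>v. fst v * F' v + a 0 * snd v ^ Suc d)"
    unfolding F F'_def by (simp add: fun_eq_iff sum.atMost_Suc_shift sum_distrib_left mult_ac del: sum.atMost_Suc)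
  ultimately show ?thesis using that by blast
qed

section \<open>Generic points: statements about almost all \<open>(t, 1)\<close>\<close>

lemma infinite_UNIV_alg_closed: "infinite (UNIV :: 'k::alg_closed_field set)"
proof
  assume fin: "finite (UNIV :: 'k set)"
  \<comment> \<open>Over a finite field this polynomial has positive degree and takes the value 1
    everywhere.\<close>
  define p where "p = (\<Prod>a\<in>UNIV. [:- a, 1:]) + (1 :: 'k poly)"
  have d: "degree (\<Prod>a\<in>UNIV. [:- a, 1::'k:]) = card (UNIV :: 'k set)"
    by (subst degree_prod_eq_sum_degree) auto
  have "degree p = card (UNIV :: 'k set)"
    unfolding p_def d[symmetric] using fin d by (intro degree_add_eq_left) (simp add: card_gt_0_iff)
  then obtain x where "poly p x = 0"
    using alg_closed_imp_poly_has_root[of p] fin by (auto simp: card_gt_0_iff)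
  moreover have "poly (\<Prod>a\<in>UNIV. [:- a, 1::'k:]) x = 0"
    using fin by (auto simp: poly_prod)
  ultimately show False by (simp add: p_def)
qed

text \<open>Cofinite subsets of an infinite field are nonempty, so a statement free of
  \<open>t\<close> can be drawn out of a generic argument; contradictions arise by taking
  \<open>False\<close> for \<open>P\<close>.\<close>

lemma MOST_not_const:
  assumes "MOST t::'k::alg_closed_field. P"
  shows P
  using assms infinite_UNIV_alg_closed[where 'k = 'k] by (simp add: MOST_iff_cofinite)

lemma MOST_imp_ex:
  fixes P :: "'k::alg_closed_field \<Rightarrow> bool"
  assumes "MOST t. P t"
  shows "\<exists>t. P t"
  using MOST_not_const[of "\<exists>t. P t", where 'k = 'k] eventually_mono[OF assms, of "\<lambda>_. \<exists>t. P t"] by blast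

lemma form_nonzero_MOST:
  assumes "F \<in> forms d" "F v \<noteq> 0"
  shows "MOST t. F (t, 1) \<noteq> 0"
proof -
  obtain p where p: "degree p \<le> d" "F = (\<lambda>(x, y). \<Sum>i\<le>d. poly.coeff p i * x ^ i * y ^ (d - i))"
    using assms(1) by (auto simp: forms_iff_poly)
  have "p \<noteq> 0" using assms(2) p(2) by (auto simp: case_prod_unfold)
  then show ?thesis
    using poly_roots_finite[of p] form_affine[OF p(2,1)] by (simp add: MOST_iff_cofinite)
qed

text \<open>A nonzero difference would have only finitely many zeros \<open>(t, 1)\<close>. The
  common degree makes the difference a form, so the conclusion also reaches \<open>(1, 0)\<close>,
  which no \<open>(t, 1)\<close> represents.\<close>

lemma form_eqI_MOST:
  fixes F :: "'k::alg_closed_field \<times> 'k \<Rightarrow> 'k"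
  assumes "F \<in> forms d" "G \<in> forms d" "MOST t. F (t, 1) = G (t, 1)"
  shows "F v = G v"
proof (rule ccontr)
  assume "F v \<noteq> G v"
  then have "MOST t. F (t, 1) - G (t, 1) \<noteq> 0"
    using form_nonzero_MOST[OF form_diff[OF assms(1,2)], of v] by simp
  with assms(3) have "MOST t::'k. False" by eventually_elim simp
  then show False by (rule MOST_not_const)
qed

lemma form_cancel:
  fixes F :: "'k::alg_closed_field \<times> 'k \<Rightarrow> 'k"
  assumes "F \<in> forms d" "G \<in> forms d" "H \<in> forms e" "H w \<noteq> 0" "\<And>v. H v * F v = H v * G v"
  shows "F v = G v"
  using assms(1,2)
proof (rule form_eqI_MOST)
  show "MOST t. F (t, 1) = G (t, 1)"
    using form_nonzero_MOST[OF assms(3,4)] by eventually_elim (metis assms(5) mult_left_cancel)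
qed

section \<open>Zeros of a form and their linear factors\<close>

lemma form_has_zero:
  fixes F :: "'k::alg_closed_field \<times> 'k \<Rightarrow> 'k"
  assumes "F \<in> forms d" "d > 0"
  obtains v where "v \<noteq> (0, 0)" "F v = 0"
proof -
  obtain p where p: "degree p \<le> d" "F = (\<lambda>(x, y). \<Sum>i\<le>d. poly.coeff p i * x ^ i * y ^ (d - i))"
    using assms(1) by (auto simp: forms_iff_poly)
  show ?thesis
  proof (cases "degree p = d")
    case True
    then obtain t where "poly p t = 0" using alg_closed_imp_poly_has_root[of p] assms(2) by auto
    then show ?thesis using form_affine[OF p(2,1)] by (intro that[of "(t, 1)"]) auto
  next
    case False
    \<comment> \<open>If the affine polynomial has degree below \<open>d\<close>, the coefficient of
      \<open>x ^ d\<close> vanishes and a zero lies at infinity.\<close>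
    then have "poly.coeff p d = 0" using p(1) by (simp add: coeff_eq_0)
    moreover have "F (1, 0) = poly.coeff p d"
      unfolding p(2) prod.case
      by (subst sum.remove[of _ d]) (auto intro!: sum.neutral simp: power_0_left)
    ultimately show ?thesis by (intro that[of "(1, 0)"]) auto
  qed
qed

text \<open>The linear form vanishes exactly on the line through \<open>v\<close>. Away from
  infinity the factor comes from the root \<open>fst v / snd v\<close> of the affine polynomial; at
  infinity the top coefficient is missing, so the second coordinate is a factor.\<close>

lemma form_divide_linear:
  fixes F :: "'k::alg_closed_field \<times> 'k \<Rightarrow> 'k"
  assumes "F \<in> forms (Suc d)" "F v = 0" "v \<noteq> (0, 0)"
  obtains F' where "F' \<in> forms d" "\<And>w. F w = (snd v * fst w - fst v * snd w) * F' w"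
proof (cases "snd v = 0")
  case True
  obtain a where F: "F = (\<lambda>(x, y). \<Sum>i\<le>Suc d. a i * x ^ i * y ^ (Suc d - i))"
    using assms by (auto simp: forms_def)
  have nz: "fst v \<noteq> 0" using True assms(3) by (cases v) auto
  have "F v = (\<Sum>i\<le>Suc d. if i = Suc d then a i * fst v ^ i else 0)"
    unfolding F case_prod_unfold True
    by (intro sum.cong refl) (auto simp: power_0_left)
  then have "a (Suc d) = 0" using assms(2) nz by simp
  then have "F w = snd w * (\<Sum>i\<le>d. a i * fst w ^ i * snd w ^ (d - i))" for w
    unfolding F by (cases w) (auto simp: sum_distrib_left Suc_diff_le mult_ac intro!: sum.cong)
  moreover have "(\<lambda>w. \<Sum>i\<le>d. a i * fst w ^ i * snd w ^ (d - i)) \<in> forms d"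
    by (auto simp: forms_def case_prod_unfold)
  \<comment> \<open>In this case the linear form is \<open>- fst v * snd w\<close>, which explains
    the constant.\<close>
  ultimately show ?thesis
    using nz True by (intro that[OF form_cmult[of _ _ "- (1 / fst v)"]]) auto
next
  case False
  obtain p where p: "degree p \<le> Suc d"
      "F = (\<lambda>(x, y). \<Sum>i\<le>Suc d. poly.coeff p i * x ^ i * y ^ (Suc d - i))"
    using assms(1) by (auto simp: forms_iff_poly)
  have "F v = snd v ^ Suc d * F (fst v / snd v, 1)"
    using form_scale[OF assms(1), of "snd v" "fst v / snd v" 1] False by simp
  then have "poly p (fst v / snd v) = 0"
    using assms(2) False form_affine[OF p(2,1)] by simp
  then obtain q where q: "p = [:- (fst v / snd v), 1:] * q"
    by (auto simp: poly_eq_0_iff_dvd)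
  have "degree q \<le> d"
  proof (cases "q = 0")
    case False
    then show ?thesis using p(1) unfolding q by (subst (asm) degree_mult_eq) auto
  qed auto
  define G where "G = (\<lambda>(x, y). \<Sum>i\<le>d. poly.coeff q i * x ^ i * y ^ (d - i))"
  have G: "G \<in> forms d" using \<open>degree q \<le> d\<close> by (auto simp: G_def forms_iff_poly)
  have Gt: "G (t, 1) = poly q t" for t using form_affine[OF G_def] \<open>degree q \<le> d\<close> by simp
  \<comment> \<open>The factor \<open>1 / snd v\<close> compensates for replacing
    \<open>t - fst v / snd v\<close> by \<open>snd v * t - fst v\<close>.\<close>
  have G': "(\<lambda>w. 1 / snd v * G w) \<in> forms d" by (rule form_cmult[OF G])
  have "F w = (snd v * fst w - fst v * snd w) * (1 / snd v * G w)" for w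
  proof (rule form_eqI_MOST[OF assms(1)])
    show "(\<lambda>w. (snd v * fst w - fst v * snd w) * (1 / snd v * G w)) \<in> forms (Suc d)"
      using form_mult[OF form_linear G'] by simp
    show "MOST t. F (t, 1) = (snd v * fst (t, 1) - fst v * snd (t, 1)) * (1 / snd v * G (t, 1))"
      using False by (intro always_eventually allI) (simp add: form_affine[OF p(2,1)] Gt q field_simps)
  qed
  then show ?thesis using G' that by blast
qed

section \<open>Two forms without common zeros\<close>

text \<open>Coprimality of two forms over an algebraically closed field, phrased by points because
  forms are functions. The origin is excluded since every form of positive degree vanishes
  there.\<close>

definition no_common_zero :: "('k::field \<times> 'k \<Rightarrow> 'k) \<Rightarrow> ('k \<times> 'k \<Rightarrow> 'k) \<Rightarrow> bool" where
  "no_common_zero F G \<longleftrightarrow> (\<forall>v. v \<noteq> (0, 0) \<longrightarrow> F v = 0 \<longrightarrow> G v \<noteq> 0)"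

lemma no_common_zero_power: "no_common_zero F G \<Longrightarrow> no_common_zero F (\<lambda>v. G v ^ n)"
  by (auto simp: no_common_zero_def)

text \<open>Euclid's lemma, by splitting off the linear factors of \<open>P\<close>: a zero of
  \<open>P\<close> is not a zero of \<open>Q\<close>, so the relation makes it a zero of
  \<open>B\<close>, and the linear factor shared by \<open>P\<close> and \<open>B\<close>
  cancels.\<close>

lemma form_euclid:
  fixes P :: "'k::alg_closed_field \<times> 'k \<Rightarrow> 'k"
  assumes "P \<in> forms d" "Q \<in> forms e" "no_common_zero P Q"
    "A \<in> forms (e + b)" "B \<in> forms (d + b)" "\<And>v. P v * A v = Q v * B v"
  obtains C where "C \<in> forms b" "\<And>v. B v = P v * C v"
  using assms
proof (induction d arbitrary: P B thesis)
  case 0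
  obtain c where P: "P = (\<lambda>_. c)" using form_0E 0 by blast
  show ?case
  proof (cases "c = 0")
    case False
    show ?thesis using 0(6) False by (intro 0(1)[OF form_cmult[of B b "1 / c"]]) (auto simp: P)
  next
    case True
    \<comment> \<open>With \<open>P = 0\<close> any zero of \<open>Q\<close> would be a common zero,
      so \<open>Q\<close> is a nonzero constant.\<close>
    have "e = 0"
      using form_has_zero[OF 0(3)] 0(4) True by (auto simp: no_common_zero_def P)
    then obtain q where q: "Q = (\<lambda>_. q)" using form_0E 0 by blast
    have "q \<noteq> 0" using 0(4) True by (auto simp: no_common_zero_def P q dest!: spec[of _ 1])
    then have "B v = 0" for v using 0(7)[of v] True by (simp add: P q)
    then show ?thesis using 0(1)[OF form_zero] by simp
  qed
next
  case (Suc d)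
  obtain v where v: "v \<noteq> (0, 0)" "P v = 0" using form_has_zero[OF Suc.prems(2)] by auto
  define l where "l w = snd v * fst w - fst v * snd w" for w
  have "Q v \<noteq> 0" using Suc.prems(4) v unfolding no_common_zero_def by blast
  then have "B v = 0" using Suc.prems(7)[of v] v by auto
  obtain P' where P': "P' \<in> forms d" "\<And>w. P w = l w * P' w"
    using form_divide_linear[OF Suc.prems(2) v(2,1)] unfolding l_def by blast
  obtain B' where B': "B' \<in> forms (d + b)" "\<And>w. B w = l w * B' w"
    using form_divide_linear[of B "d + b" v] Suc.prems(6) \<open>B v = 0\<close> v unfolding l_def by auto
  have l: "l \<in> forms 1" unfolding l_def[abs_def] by (rule form_linear)
  \<comment> \<open>Cancelling \<open>l\<close> requires that it is not the zero form.\<close>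
  obtain u where u: "l u \<noteq> 0"
  proof (cases "snd v = 0")
    case True
    then show ?thesis using v(1) by (intro that[of "(0, 1)"]) (cases v, auto simp: l_def)
  qed (auto intro!: that[of "(1, 0)"] simp: l_def)
  have "P' w * A w = Q w * B' w" for w
  proof (rule form_cancel[where H = l and F = "\<lambda>w. P' w * A w" and G = "\<lambda>w. Q w * B' w", OF _ _ l u])
    show "(\<lambda>w. P' w * A w) \<in> forms (d + (e + b))" using P' Suc.prems by (intro form_mult)
    show "(\<lambda>w. Q w * B' w) \<in> forms (d + (e + b))" 
      using form_mult[OF Suc.prems(3) B'(1)] by (simp add: add_ac)
    show "l w * (P' w * A w) = l w * (Q w * B' w)" for w
      using Suc.prems(7)[of w] P'(2)[of w] B'(2)[of w] by (simp add: mult_ac)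
  qed
  moreover have "no_common_zero P' Q" using Suc.prems(4) P'(2) by (simp add: no_common_zero_def)
  ultimately obtain C where "C \<in> forms b" "\<And>v. B' v = P' v * C v"
    using Suc.IH[OF _ P'(1) Suc.prems(3) _ Suc.prems(5) B'(1)] by metis
  then show ?case using P'(2) B'(2) by (intro Suc.prems(1)) auto
qed

text \<open>Interpolation at a zero of \<open>P\<close>: subtracting a multiple of \<open>Q\<close>
  with the same value as \<open>F\<close> there makes the difference divisible by the linear factor.
  This lowers \<open>d\<close> and \<open>n\<close> together, so the bound
  \<open>d + e \<le> n + 1\<close> is preserved. Subtraction of degrees is truncated, hence the
  clause that \<open>B\<close> is zero when \<open>n < e\<close>; by the bound this happens only for
  \<open>d = 0\<close>.\<close>

lemma form_bezout:
  fixes P :: "'k::alg_closed_field \<times> 'k \<Rightarrow> 'k"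
  assumes "P \<in> forms d" "Q \<in> forms e" "no_common_zero P Q" "F \<in> forms n" "d + e \<le> Suc n"
  obtains A B where "A \<in> forms (n - d)" "B \<in> forms (n - e)" "n < e \<Longrightarrow> B = (\<lambda>_. 0)"
    "\<And>v. F v = P v * A v + Q v * B v"
  using assms
proof (induction d arbitrary: P F n thesis)
  case 0
  obtain c where P: "P = (\<lambda>_. c)" using form_0E 0 by blast
  show ?case
  proof (cases "c = 0")
    case False
    show ?thesis
      using 0(5) False by (intro 0(1)[of "\<lambda>v. 1 / c * F v" "\<lambda>_. 0"]) (auto simp: P form_zero intro: form_cmult[of F n "1 / c", simplified])
  next
    case True
    have "e = 0"
      using form_has_zero[OF 0(3)] 0(4) True by (auto simp: no_common_zero_def P)
    then obtain q where q: "Q = (\<lambda>_. q)" using form_0E 0 by blast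
    have "q \<noteq> 0" using 0(4) True by (auto simp: no_common_zero_def P q dest!: spec[of _ 1])
    then show ?thesis using 0(5) \<open>e = 0\<close>
      by (intro 0(1)[of "\<lambda>_. 0" "\<lambda>v. 1 / q * F v"]) (auto simp: q form_zero intro: form_cmult[of F n "1 / q", simplified])
  qed
next
  case (Suc d)
  obtain v where v: "v \<noteq> (0, 0)" "P v = 0" using form_has_zero[OF Suc.prems(2)] by auto
  define l where "l w = snd v * fst w - fst v * snd w" for w
  have Qv: "Q v \<noteq> 0" using Suc.prems(4) v unfolding no_common_zero_def by blast
  show ?case
  proof (cases "e = 0")
    case True
    then obtain q where q: "Q = (\<lambda>_. q)" using form_0E Suc.prems(3) by blast
    then show ?thesis using Suc.prems(5) Qv True
      by (intro Suc.prems(1)[of "\<lambda>_. 0" "\<lambda>v. 1 / q * F v"])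
        (auto simp: form_zero intro: form_cmult[of F n "1 / q", simplified])
  next
    case False
    obtain m where m: "n = Suc m" "e \<le> n" using Suc.prems(6) False by (cases n) auto
    obtain P' where P': "P' \<in> forms d" "\<And>w. P w = l w * P' w"
      using form_divide_linear[OF Suc.prems(2) v(2,1)] unfolding l_def by blast
    \<comment> \<open>A power of a coordinate that is nonzero at \<open>v\<close>; rescaled, it
      takes any prescribed value there.\<close>
    obtain T0 where T0: "T0 \<in> forms (n - e)" "T0 v \<noteq> 0"
    proof (cases "fst v = 0")
      case True
      then have "snd v \<noteq> 0" using v(1) by (metis prod.collapse)
      then show ?thesis
        using form_power[OF form_snd, of "n - e"]
        by (intro that[of "\<lambda>v. snd v ^ (n - e)"]) (auto simp: prod_eq_iff)
    next
      case False
      then show ?thesis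
        using form_power[OF form_fst, of "n - e"] by (intro that[of "\<lambda>v. fst v ^ (n - e)"]) auto
    qed
    define T where "T w = F v / (Q v * T0 v) * T0 w" for w
    have T: "T \<in> forms (n - e)" unfolding T_def[abs_def] by (rule form_cmult[OF T0(1)])
    have "(\<lambda>w. F w - Q w * T w) \<in> forms (Suc m)"
      using form_diff[OF Suc.prems(5)] form_mult[OF Suc.prems(3) T] m by simp
    moreover have "F v - Q v * T v = 0" using Qv T0 by (simp add: T_def)
    ultimately obtain F' where F': "F' \<in> forms m" "\<And>w. F w - Q w * T w = l w * F' w"
      using form_divide_linear[of "\<lambda>w. F w - Q w * T w" m v] v unfolding l_def by auto
    have l: "l \<in> forms 1" unfolding l_def[abs_def] by (rule form_linear)
    have "no_common_zero P' Q" using Suc.prems(4) P'(2) by (simp add: no_common_zero_def)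
    then obtain A B where AB: "A \<in> forms (m - d)" "B \<in> forms (m - e)" "m < e \<Longrightarrow> B = (\<lambda>_. 0)"
        "\<And>v. F' v = P' v * A v + Q v * B v"
      using Suc.IH[OF _ P'(1) Suc.prems(3) _ F'(1)] Suc.prems(6) m by auto
    \<comment> \<open>If \<open>e = n\<close>, then \<open>B\<close> should have degree -1. The
      induction hypothesis gives \<open>B = 0\<close>, and \<open>T\<close> alone has the right
      degree.\<close>
    have lB: "(\<lambda>w. T w + l w * B w) \<in> forms (n - e)"
    proof (cases "e \<le> m")
      case True
      then show ?thesis using form_add[OF T] form_mult[OF l AB(2)] m by (simp add: Suc_diff_le)
    next
      case False
      then show ?thesis using T AB(3) by simp
    qed
    have "F w = P w * A w + Q w * (T w + l w * B w)" for w
      using F'(2)[of w] AB(4)[of w] P'(2)[of w] by (simp add: algebra_simps)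
    then show ?thesis using AB(1) lB m by (intro Suc.prems(1)) auto
  qed
qed

section \<open>The decomposition of forms of degree \<open>m d\<close>\<close>

lemma form_coeff_zero:
  fixes c :: "nat \<Rightarrow> 'k::alg_closed_field"
  assumes "\<And>v. (\<Sum>l\<le>d. c l * fst v ^ l * snd v ^ (d - l)) = 0" "l \<le> d"
  shows "c l = 0"
proof -
  define p where "p = (\<Sum>i\<le>d. Polynomial.monom (c i) i)"
  have "poly p t = 0" for t
    using assms(1)[of "(t, 1)"] by (simp add: p_def poly_sum poly_monom)
  then have "p = 0"
    using poly_roots_finite[of p] infinite_UNIV_alg_closed[where 'k = 'k] by auto
  moreover have "poly.coeff p l = c l" using assms(2) by (simp add: p_def coeff_sum)
  ultimately show ?thesis by simp
qed

text \<open>Exchange in the monomial basis: \<open>P\<close> and \<open>Q\<close> are not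
  proportional, so some two-by-two minor of their coefficients is nonzero, and they can replace the
  two monomials concerned. The other \<open>d - 1\<close> monomials become \<open>G 1\<close> up to
  \<open>G (d - 1)\<close>. With \<open>G 0 = Q\<close> the quotients \<open>G i / Q\<close> start
  with 1. The last clause is independence modulo \<open>P\<close>, the form in which it is
  applied.\<close>

lemma form_basis:
  fixes P :: "'k::alg_closed_field \<times> 'k \<Rightarrow> 'k"
  assumes P: "P \<in> forms d" and Q: "Q \<in> forms d" and PQ: "no_common_zero P Q" and "d > 0"
  obtains G where "G 0 = Q" "\<And>i. i < d \<Longrightarrow> G i \<in> forms d"
    "\<And>F. F \<in> forms d \<Longrightarrow> \<exists>\<alpha> c. \<forall>v. F v = \<alpha> * P v + (\<Sum>i<d. c i * G i v)"
    "\<And>\<alpha> c i. (\<And>v. \<alpha> * P v = (\<Sum>i<d. c i * G i v)) \<Longrightarrow> i < d \<Longrightarrow> c i = 0"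
proof -
  define mono where "mono l v = fst v ^ l * snd v ^ (d - l)" for l and v :: "'k \<times> 'k"
  have mono0: "c l = 0" if "\<And>v. (\<Sum>l\<le>d. c l * mono l v) = 0" "l \<le> d" for c l
    using form_coeff_zero[of c d l] that by (simp add: mono_def mult.assoc)
  have formE: "\<exists>a. \<forall>v. F v = (\<Sum>l\<le>d. a l * mono l v)" if "F \<in> forms d" for F
    using that by (force simp: forms_def mono_def mult.assoc)
  obtain a where a: "P v = (\<Sum>l\<le>d. a l * mono l v)" for v using formE[OF P] by blast
  obtain b where b: "Q v = (\<Sum>l\<le>d. b l * mono l v)" for v using formE[OF Q] by blast
  obtain v where v: "v \<noteq> (0, 0)" "Q v = 0" using form_has_zero[OF Q \<open>d > 0\<close>] by auto
  then have "P v \<noteq> 0" using PQ by (auto simp: no_common_zero_def simp del: split_paired_All)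
  then obtain i where i: "i \<le> d" "a i \<noteq> 0" unfolding a by (force elim: sum.not_neutral_contains_not_neutral)
  obtain v where v: "v \<noteq> (0, 0)" "P v = 0" using form_has_zero[OF P \<open>d > 0\<close>] by auto
  then have Qv: "Q v \<noteq> 0" using PQ by (auto simp: no_common_zero_def simp del: split_paired_All)
  \<comment> \<open>If all these minors vanished, \<open>a i * Q = b i * P\<close> would hold, which
    fails at a zero of \<open>P\<close>.\<close>
  have "\<exists>j\<le>d. a i * b j \<noteq> a j * b i"
  proof (rule ccontr)
    assume "\<not> ?thesis"
    then have *: "a i * b j = b i * a j" if "j \<le> d" for j using that by (simp add: mult.commute)
    have "a i * Q v = (\<Sum>l\<le>d. (a i * b l) * mono l v)" by (simp add: b sum_distrib_left mult.assoc)
    also have "\<dots> = b i * P v" by (simp add: * a sum_distrib_left mult.assoc)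
    finally show False using v Qv i by simp
  qed
  then obtain j where j: "j \<le> d" "a i * b j \<noteq> a j * b i" by blast
  define D where "D = a i * b j - a j * b i"
  have D: "D \<noteq> 0" using j by (simp add: D_def)
  have ij: "i \<noteq> j" using j by (auto simp: mult.commute)
  obtain d' where d': "d = Suc d'" using \<open>d > 0\<close> by (cases d) auto
  define I where "I = {..d} - {i, j}"
  have "card I = d'" using i(1) j(1) ij by (simp add: I_def card_Diff_subset d')
  then obtain h where h: "bij_betw h {..<d'} I"
    using ex_bij_betw_nat_finite[of I] by (auto simp: I_def atLeast0LessThan)
  define G where "G k = (if k = 0 then Q else mono (h (k - 1)))" for k
  have Gsum: "(\<Sum>k<d. c k * G k v) = c 0 * Q v + (\<Sum>k<d'. c (Suc k) * mono (h k) v)" for c v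
    unfolding d' by (subst sum.lessThan_Suc_shift) (simp add: G_def)
  have split: "(\<Sum>l\<le>d. e l * mono l v) = e i * mono i v + e j * mono j v + (\<Sum>l\<in>I. e l * mono l v)"
    for e v
    unfolding I_def using i(1) j(1) ij
    by (simp add: sum.remove[of "{..d}" i] sum.remove[of "{..d} - {i}" j] Diff_insert2[symmetric] add.assoc)
  show ?thesis
  proof
    show "G 0 = Q" by (simp add: G_def)
    show "G k \<in> forms d" if "k < d" for k
    proof (cases k)
      case (Suc k')
      then have "h k' \<in> I" using h that by (auto simp: bij_betw_def d')
      then show ?thesis using Suc form_monomial[of "h k'" d] by (simp add: G_def mono_def[abs_def] I_def)
    qed (simp add: G_def Q)
    show "\<exists>\<alpha> c. \<forall>v. F v = \<alpha> * P v + (\<Sum>i<d. c i * G i v)" if F: "F \<in> forms d" for F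
    proof -
      obtain e where e: "F v = (\<Sum>l\<le>d. e l * mono l v)" for v using formE[OF F] by blast
      \<comment> \<open>Cramer's rule for the coefficients at \<open>i\<close> and \<open>j\<close>;
        the remainder \<open>r\<close> is supported on the other monomials.\<close>
      define \<alpha> where "\<alpha> = (e i * b j - e j * b i) / D"
      define \<beta> where "\<beta> = (a i * e j - a j * e i) / D"
      define r where "r l = e l - \<alpha> * a l - \<beta> * b l" for l
      have ri: "r i = 0" and rj: "r j = 0"
        using D by (simp_all add: r_def \<alpha>_def \<beta>_def divide_simps) (simp_all add: D_def algebra_simps)
      define c where "c k = (if k = 0 then \<beta> else r (h (k - 1)))" for k
      have "F v = \<alpha> * P v + (\<Sum>i<d. c i * G i v)" for v
      proof -
        have "(\<Sum>k<d'. c (Suc k) * mono (h k) v) = (\<Sum>l\<in>I. r l * mono l v)"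
          by (simp add: c_def sum.reindex_bij_betw[OF h, of "\<lambda>l. r l * mono l v"])
        also have "\<dots> = (\<Sum>l\<le>d. r l * mono l v)" by (simp add: split ri rj)
        also have "\<dots> = F v - \<alpha> * P v - \<beta> * Q v"
          by (simp add: r_def e a b sum_distrib_left sum_subtractf sum.distrib algebra_simps)
        finally show ?thesis by (simp add: Gsum c_def)
      qed
      then show ?thesis by blast
    qed
    show "c k = 0" if eq: "\<And>v. \<alpha> * P v = (\<Sum>i<d. c i * G i v)" and k: "k < d" for \<alpha> c k
    proof -
      define h' where "h' = the_inv_into {..<d'} h"
      have h': "h' (h k) = k" if "k < d'" for k
        using that h by (simp add: h'_def the_inv_into_f_f bij_betw_def)
      \<comment> \<open>The coefficient of the \<open>l\<close>-th monomial in
        \<open>\<alpha> * P\<close> minus the combination of the \<open>G k\<close>;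
        \<open>h'\<close> recovers the index belonging to a monomial.\<close>
      define e where "e l = \<alpha> * a l - c 0 * b l - (if l \<in> I then c (Suc (h' l)) else 0)" for l
      have e0: "e l = 0" if "l \<le> d" for l
      proof (rule mono0[OF _ that])
        fix v
        have "(\<Sum>k<d'. c (Suc k) * mono (h k) v) = (\<Sum>k<d'. c (Suc (h' (h k))) * mono (h k) v)"
          by (simp add: h')
        also have "\<dots> = (\<Sum>l\<in>I. c (Suc (h' l)) * mono l v)"
          by (rule sum.reindex_bij_betw[OF h, of "\<lambda>l. c (Suc (h' l)) * mono l v"])
        also have "\<dots> = (\<Sum>l\<le>d. (if l \<in> I then c (Suc (h' l)) else 0) * mono l v)"
          by (rule sum.mono_neutral_cong_left) (auto simp: I_def)
        finally show "(\<Sum>l\<le>d. e l * mono l v) = 0"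
          using eq[of v] unfolding Gsum
          by (simp add: e_def a b sum_distrib_left sum_subtractf sum.distrib algebra_simps)
      qed
      have i0: "\<alpha> * a i = c 0 * b i" and j0: "\<alpha> * a j = c 0 * b j"
        using e0[OF i(1)] e0[OF j(1)] by (simp_all add: e_def I_def)
      have "c 0 * D = a i * (c 0 * b j) - a j * (c 0 * b i)" by (simp add: D_def algebra_simps)
      also have "\<dots> = 0" unfolding i0[symmetric] j0[symmetric] by (simp add: algebra_simps)
      finally have c0: "c 0 = 0" using D by simp
      then have "\<alpha> = 0" using i0 i(2) by simp
      show "c k = 0"
      proof (cases k)
        case (Suc k')
        then have "h k' \<in> I" "h' (h k') = k'" using h h' k by (auto simp: bij_betw_def d')
        then show ?thesis using e0[of "h k'"] Suc c0 \<open>\<alpha> = 0\<close> by (simp add: e_def I_def)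
      qed (use c0 in simp)
    qed
  qed
qed

locale two_forms =
  fixes P Q :: "'k::alg_closed_field \<times> 'k \<Rightarrow> 'k" and d :: nat and G :: "nat \<Rightarrow> 'k \<times> 'k \<Rightarrow> 'k"
  assumes P: "P \<in> forms d" and Q: "Q \<in> forms d" and PQ: "no_common_zero P Q" and d: "d > 0"
    and G0: "G 0 = Q" and G: "i < d \<Longrightarrow> G i \<in> forms d"
    and G_span: "F \<in> forms d \<Longrightarrow> \<exists>\<alpha> c. \<forall>v. F v = \<alpha> * P v + (\<Sum>i<d. c i * G i v)"
    and G_indep: "(\<And>v. \<alpha> * P v = (\<Sum>i<d. c i * G i v)) \<Longrightarrow> i < d \<Longrightarrow> c i = 0"
begin

lemma P_nonzero: obtains v where "P v \<noteq> 0"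
proof -
  obtain v where v: "v \<noteq> (0, 0)" "Q v = 0" using form_has_zero[OF Q d] by auto
  then show ?thesis using PQ that unfolding no_common_zero_def by blast
qed

text \<open>Reduction modulo \<open>P\<close>: in the step to \<open>Suc m\<close>, the pure powers
  of the second coordinate contribute \<open>Q ^ Suc m\<close> times a combination of the
  \<open>G i\<close>, and the rest is divisible by \<open>P\<close>. Being prime to
  \<open>Q\<close>, the form \<open>P\<close> divides that combination; degrees leave a constant
  quotient, and independence modulo \<open>P\<close> kills the coefficients. All \<open>S i\<close>
  have the same degree, including the one at \<open>G 0 = Q\<close>, because the lemma is applied to
  relations between the quotients \<open>G i / Q\<close>.\<close>

lemma forms_independent:
  assumes "\<And>i. i < d \<Longrightarrow> S i \<in> forms m" "\<And>v. (\<Sum>i<d. S i (P v, Q v) * G i v) = 0" "i < d"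
  shows "S i w = 0"
  using assms
proof (induction m arbitrary: S i w)
  case 0
  have "\<forall>i. \<exists>c. i < d \<longrightarrow> S i = (\<lambda>_. c)" using 0(1) form_0E by metis
  then obtain c where c: "\<And>i. i < d \<Longrightarrow> S i = (\<lambda>_. c i)" by metis
  have "c i = 0" using G_indep[of 0 c i] 0(2,3) c by simp
  then show ?case using c 0(3) by simp
next
  case (Suc m)
  have "\<forall>i. \<exists>S' c. i < d \<longrightarrow> S' \<in> forms m \<and> S i = (\<lambda>v. fst v * S' v + c * snd v ^ Suc m)"
    using Suc.prems(1) form_Suc_split by metis
  then obtain S' c where S': "\<And>i. i < d \<Longrightarrow> S' i \<in> forms m"
    and S: "\<And>i. i < d \<Longrightarrow> S i = (\<lambda>v. fst v * S' i v + c i * snd v ^ Suc m)" by metis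
  define A where "A v = (\<Sum>i<d. S' i (P v, Q v) * G i v)" for v
  define B where "B v = (\<Sum>i<d. - c i * G i v)" for v
  have A: "A \<in> forms (Suc m * d)"
    unfolding A_def[abs_def]
  proof (rule form_sum)
    fix i assume "i \<in> {..<d}"
    then show "(\<lambda>v. S' i (P v, Q v) * G i v) \<in> forms (Suc m * d)"
      using form_mult[OF form_compose[OF S' P Q] G, of i i] by (simp add: add.commute)
  qed
  have B: "B \<in> forms d"
    unfolding B_def[abs_def] by (intro form_sum form_cmult G) auto
  have eq: "P v * A v = Q v ^ Suc m * B v" for v
  proof -
    have "P v * A v - Q v ^ Suc m * B v = (\<Sum>i<d. S i (P v, Q v) * G i v)"
      unfolding A_def B_def sum_distrib_left sum_subtractf[symmetric]
      by (rule sum.cong) (auto simp: S algebra_simps)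
    then show ?thesis using Suc.prems(2) by simp
  qed
  obtain C where C: "C \<in> forms 0" "\<And>v. B v = P v * C v"
    using form_euclid[OF P form_power[OF Q] no_common_zero_power[OF PQ], of A "Suc m" 0 B] A B eq by auto
  obtain \<gamma> where "C = (\<lambda>_. \<gamma>)" using C(1) by (rule form_0E)
  then have c: "c i = 0" if "i < d" for i
    using G_indep[of \<gamma> "\<lambda>i. - c i" i] that C(2) by (simp add: B_def mult.commute)
  \<comment> \<open>The relation is now \<open>P * A = 0\<close>; cancelling \<open>P\<close> leaves
    a relation with coefficients of one degree less.\<close>
  obtain u where u: "P u \<noteq> 0" by (rule P_nonzero)
  have "A v = 0" for v
    using form_cancel[OF A form_zero P u, of v] eq c by (simp add: B_def)
  then have "S' i w = 0" if "i < d" for i w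
    using Suc.IH[of S' i w, OF S'] that by (simp add: A_def)
  then show ?case using S c Suc.prems(3) by simp
qed

text \<open>From degree \<open>2 * d\<close> on, a form is \<open>P * A + Q * B\<close>, and the
  decompositions of \<open>A\<close> and \<open>B\<close> combine with the coordinates
  \<open>x\<close> and \<open>y\<close> as multipliers. In the initial degree \<open>d\<close>,
  which for \<open>d > 1\<close> lies below the range of that argument, the basis is used directly
  and the coefficient of \<open>Q\<close> is absorbed into \<open>R\<close>.\<close>

lemma forms_span_Suc:
  assumes "F \<in> forms (Suc m * d)"
  obtains R S where "R \<in> forms (Suc m)" "\<And>i. S i \<in> forms m"
    "\<And>v. F v = R (P v, Q v) + (\<Sum>i<d - 1. S i (P v, Q v) * G (Suc i) v)"
  using assms
proof (induction m arbitrary: F thesis)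
  case 0
  obtain \<alpha> c where Fv: "F v = \<alpha> * P v + (\<Sum>i<d. c i * G i v)" for v using G_span[of F] 0 by auto
  obtain d' where d': "d = Suc d'" using d by (cases d) auto
  have "F v = \<alpha> * P v + c 0 * Q v + (\<Sum>i<d - 1. c (Suc i) * G (Suc i) v)" for v
    unfolding Fv d' by (subst sum.lessThan_Suc_shift) (simp add: G0)
  then show ?case
    by (intro 0(1)[of "\<lambda>v. \<alpha> * fst v + c 0 * snd v" "\<lambda>i _. c (Suc i)"])
      (auto intro!: form_const form_add form_cmult form_fst[simplified] form_snd[simplified])
next
  case (Suc m)
  obtain A B where AB: "A \<in> forms (Suc m * d)" "B \<in> forms (Suc m * d)" "\<And>v. F v = P v * A v + Q v * B v"
    using form_bezout[OF P Q PQ Suc.prems(2)] by auto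
  obtain R1 S1 where 1: "R1 \<in> forms (Suc m)" "\<And>i. S1 i \<in> forms m"
    "\<And>v. A v = R1 (P v, Q v) + (\<Sum>i<d - 1. S1 i (P v, Q v) * G (Suc i) v)"
    using Suc.IH[OF _ AB(1)] by blast
  obtain R2 S2 where 2: "R2 \<in> forms (Suc m)" "\<And>i. S2 i \<in> forms m"
    "\<And>v. B v = R2 (P v, Q v) + (\<Sum>i<d - 1. S2 i (P v, Q v) * G (Suc i) v)"
    using Suc.IH[OF _ AB(2)] by blast
  have f: "(\<lambda>v. fst v * X v + snd v * Y v) \<in> forms (Suc l)" if "X \<in> forms l" "Y \<in> forms l" for X Y :: "'k \<times> 'k \<Rightarrow> 'k" and l
    using form_add[OF form_mult[OF form_fst that(1)] form_mult[OF form_snd that(2)]] by simp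
  show ?case
    by (rule Suc.prems(1)[OF f[OF 1(1) 2(1)] f[OF 1(2) 2(2)]])
      (simp add: AB(3) 1(3) 2(3) sum_distrib_left sum.distrib algebra_simps)
qed

end

section \<open>Points and the topology\<close>

text \<open>At \<open>(0, 0)\<close> the function \<open>Abs_proj_line\<close> is applied outside
  its domain and the value is arbitrary; hence the recurring condition
  \<open>v \<noteq> (0, 0)\<close>.\<close>

definition point :: "'k::field \<times> 'k \<Rightarrow> 'k proj_line" where
  "point v = Abs_proj_line (line_through v)"

definition scaled :: "'k::field \<Rightarrow> 'k \<times> 'k \<Rightarrow> 'k \<times> 'k" where
  "scaled c v = (c * fst v, c * snd v)"

lemma line_of_point: "v \<noteq> (0, 0) \<Longrightarrow> line_of (point v) = line_through v"
  unfolding point_def by (subst Abs_proj_line_inverse) blast+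

lemma point_cases [case_names point]:
  obtains v where "v \<noteq> (0, 0)" "p = point v"
proof -
  obtain v where v: "v \<noteq> (0, 0)" "line_of p = line_through v" using line_of[of p] by auto
  then have "p = point v" using line_of_inverse[of p] by (simp add: point_def)
  with v that show ?thesis by blast
qed

lemma line_through_iff: "u \<in> line_through v \<longleftrightarrow> (\<exists>c. u = scaled c v)"
  by (auto simp: line_through_def scaled_def)

lemma scaled_eq_0_iff: "v \<noteq> (0, 0) \<Longrightarrow> scaled c v = (0, 0) \<longleftrightarrow> c = 0"
  by (cases v) (auto simp: scaled_def)

lemma point_scaled:
  assumes "c \<noteq> 0"
  shows "point (scaled c v) = point v"
proof -
  have "line_through (scaled c v) = line_through v"
  proof (intro equalityI subsetI)
    fix u assume "u \<in> line_through (scaled c v)"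
    then obtain a where "u = scaled a (scaled c v)" by (auto simp: line_through_iff)
    then show "u \<in> line_through v"
      by (auto simp: line_through_iff scaled_def mult.assoc intro!: exI[of _ "a * c"])
  next
    fix u assume "u \<in> line_through v"
    then obtain a where "u = scaled a v" by (auto simp: line_through_iff)
    then show "u \<in> line_through (scaled c v)"
      using assms by (auto simp: line_through_iff scaled_def intro!: exI[of _ "a / c"])
  qed
  then show ?thesis by (simp add: point_def)
qed

lemma point_eq_iff:
  assumes "v \<noteq> (0, 0)" "w \<noteq> (0, 0)"
  shows "point v = point w \<longleftrightarrow> (\<exists>c. c \<noteq> 0 \<and> v = scaled c w)"
proof
  assume "point v = point w"
  then have "line_through v = line_through w"
    using line_of_point assms by metis
  moreover have "v \<in> line_through v" by (auto simp: line_through_iff scaled_def intro!: exI[of _ 1])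
  ultimately obtain c where "v = scaled c w" by (auto simp: line_through_iff)
  with assms show "\<exists>c. c \<noteq> 0 \<and> v = scaled c w" by (auto simp: scaled_def)
qed (auto simp: point_scaled)

lemma in_line_of_iff:
  assumes "v \<noteq> (0, 0)"
  shows "v \<in> line_of p \<longleftrightarrow> point v = p"
proof (cases p rule: point_cases)
  case (point w)
  then show ?thesis
    using point_eq_iff[OF assms, of w] assms
    by (auto simp: line_of_point line_through_iff scaled_eq_0_iff)
qed

lemma vanishes_at_point:
  "F \<in> forms d \<Longrightarrow> v \<noteq> (0, 0) \<Longrightarrow> vanishes_at F (point v) \<longleftrightarrow> F v = 0"
  by (rule vanishes_at_iff[OF _ line_of_point])

lemma form_scaled: "F \<in> forms d \<Longrightarrow> F (scaled c v) = c ^ d * F v"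
  using form_scale[of F d c "fst v" "snd v"] by (simp add: scaled_def)

text \<open>Some form in a family defining the complement is nonzero somewhere, hence at almost all
  \<open>(t, 1)\<close>. A generic parameter therefore lies in any finite number of nonempty open
  sets at once.\<close>

lemma open_MOST:
  fixes W :: "'k::alg_closed_field proj_line set"
  assumes "open W" "W \<noteq> {}"
  shows "MOST t. point (t, 1) \<in> W"
proof -
  obtain T where T: "T \<subseteq> (\<Union>d. forms d)" "- W = zero_locus T"
    using assms(1) unfolding open_proj_line_def by blast
  obtain p where "p \<in> W" using assms(2) by blast
  then obtain F where F: "F \<in> T" "\<not> vanishes_at F p" using T(2) unfolding zero_locus_def by blast
  then obtain d where d: "F \<in> forms d" using T(1) by blast
  obtain v where "v \<noteq> (0, 0)" "F v \<noteq> 0"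
    using F(2) by (cases p rule: point_cases) (auto simp: vanishes_at_point[OF d])
  then have "MOST t. F (t, 1) \<noteq> 0" using form_nonzero_MOST[OF d] by blast
  then show ?thesis
  proof eventually_elim
    case (elim t)
    then have "\<not> vanishes_at F (point (t, 1))" by (simp add: vanishes_at_point[OF d])
    then show ?case using T(2) F(1) unfolding zero_locus_def by blast
  qed
qed

text \<open>Irreducibility of the projective line.\<close>

lemma open_Int_nonempty:
  fixes U :: "'k::alg_closed_field proj_line set"
  assumes "open U" "U \<noteq> {}" "open V" "V \<noteq> {}"
  shows "U \<inter> V \<noteq> {}"
proof
  assume "U \<inter> V = {}"
  have "MOST t::'k. point (t, 1) \<in> U" "MOST t::'k. point (t, 1) \<in> V"
    by (rule open_MOST assms)+
  then have "MOST t::'k. False" by eventually_elim (use \<open>U \<inter> V = {}\<close> in blast)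
  then show False by (rule MOST_not_const)
qed

section \<open>Regular functions\<close>

definition fraction_on ::
    "'k::field proj_line set \<Rightarrow> ('k proj_line \<Rightarrow> 'k) \<Rightarrow> nat \<Rightarrow> ('k \<times> 'k \<Rightarrow> 'k) \<Rightarrow> ('k \<times> 'k \<Rightarrow> 'k) \<Rightarrow> bool"
  where "fraction_on W s d F G \<longleftrightarrow> F \<in> forms d \<and> G \<in> forms d \<and>
    (\<forall>v. v \<noteq> (0, 0) \<longrightarrow> point v \<in> W \<longrightarrow> G v \<noteq> 0 \<and> s (point v) = F v / G v)"

lemma fraction_onD:
  assumes "fraction_on W s d F G"
  shows "F \<in> forms d" "G \<in> forms d"
    "v \<noteq> (0, 0) \<Longrightarrow> point v \<in> W \<Longrightarrow> G v \<noteq> 0"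
    "v \<noteq> (0, 0) \<Longrightarrow> point v \<in> W \<Longrightarrow> s (point v) = F v / G v"
  using assms by (auto simp: fraction_on_def simp del: split_paired_All)

lemma fraction_onI:
  assumes "F \<in> forms d" "G \<in> forms d"
    "\<And>v. v \<noteq> (0, 0) \<Longrightarrow> point v \<in> W \<Longrightarrow> G v \<noteq> 0"
    "\<And>v. v \<noteq> (0, 0) \<Longrightarrow> point v \<in> W \<Longrightarrow> s (point v) = F v / G v"
  shows "fraction_on W s d F G"
  using assms by (auto simp: fraction_on_def simp del: split_paired_All)

lemma fraction_on_subset: "fraction_on U s d F G \<Longrightarrow> V \<subseteq> U \<Longrightarrow> fraction_on V s d F G"
  unfolding fraction_on_def by blast

lemma regular_on_iff:
  "regular_on U s \<longleftrightarrow>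
     (\<forall>p \<in> U. \<exists>W. open W \<and> p \<in> W \<and> W \<subseteq> U \<and> (\<exists>d F G. fraction_on W s d F G))"
proof -
  have "(\<forall>q \<in> W. \<forall>v \<in> line_of q. v \<noteq> (0, 0) \<longrightarrow> G v \<noteq> 0 \<and> s q = F v / G v) \<longleftrightarrow>
    (\<forall>v. v \<noteq> (0, 0) \<longrightarrow> point v \<in> W \<longrightarrow> G v \<noteq> 0 \<and> s (point v) = F v / G v)"
    for W :: "'a proj_line set" and F G
  proof (intro iffI ballI allI impI)
    fix v :: "'a \<times> 'a"
    assume "\<forall>q \<in> W. \<forall>v \<in> line_of q. v \<noteq> (0, 0) \<longrightarrow> G v \<noteq> 0 \<and> s q = F v / G v"
      and v: "v \<noteq> (0, 0)" "point v \<in> W"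
    then show "G v \<noteq> 0 \<and> s (point v) = F v / G v" using in_line_of_iff[OF v(1), of "point v"] by blast
  next
    fix q v
    assume *: "\<forall>v. v \<noteq> (0, 0) \<longrightarrow> point v \<in> W \<longrightarrow> G v \<noteq> 0 \<and> s (point v) = F v / G v"
      and q: "q \<in> W" "v \<in> line_of q" "v \<noteq> (0, 0)"
    then have "point v = q" using in_line_of_iff by blast
    then show "G v \<noteq> 0 \<and> s q = F v / G v" using *[rule_format, of v] q by simp
  qed
  then show ?thesis unfolding regular_on_def fraction_on_def by (simp only: ex_simps)
qed

lemma regular_onI: "open U \<Longrightarrow> fraction_on U s d F G \<Longrightarrow> regular_on U s"
  unfolding regular_on_iff by (intro ballI exI[of _ U]) auto

lemma regular_onE:
  assumes "regular_on U s" "p \<in> U"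
  obtains W d F G where "open W" "p \<in> W" "W \<subseteq> U" "fraction_on W s d F G"
  using assms unfolding regular_on_iff by (elim ballE exE conjE) auto

lemma regular_on_local:
  assumes "\<And>p. p \<in> U \<Longrightarrow> \<exists>W. open W \<and> p \<in> W \<and> W \<subseteq> U \<and> regular_on W s"
  shows "regular_on U s"
  unfolding regular_on_iff
proof
  fix p assume "p \<in> U"
  then obtain W where W: "W \<subseteq> U" "regular_on W s" "p \<in> W" using assms by blast
  obtain V d F G where "open V" "p \<in> V" "V \<subseteq> W" "fraction_on V s d F G"
    using regular_onE[OF W(2,3)] by blast
  with W(1) show "\<exists>W. open W \<and> p \<in> W \<and> W \<subseteq> U \<and> (\<exists>d F G. fraction_on W s d F G)"
    by blast
qed

lemma regular_on_cong:
  assumes "regular_on U s" "\<And>p. p \<in> U \<Longrightarrow> t p = s p"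
  shows "regular_on U t"
  unfolding regular_on_iff
proof
  fix p assume p: "p \<in> U"
  obtain W d F G where W: "open W" "p \<in> W" "W \<subseteq> U" "fraction_on W s d F G"
    using regular_onE[OF assms(1) p] by blast
  have "fraction_on W t d F G"
    using W assms(2) unfolding fraction_on_def by (simp add: subset_iff del: split_paired_All)
  with W show "\<exists>W. open W \<and> p \<in> W \<and> W \<subseteq> U \<and> (\<exists>d F G. fraction_on W t d F G)" by blast
qed

lemma regular_on_subset:
  assumes "regular_on U s" "open V" "V \<subseteq> U"
  shows "regular_on V s"
  unfolding regular_on_iff
proof
  fix p assume p: "p \<in> V"
  then obtain W d F G where W: "open W" "p \<in> W" "W \<subseteq> U" "fraction_on W s d F G"
    using regular_onE[OF assms(1)] assms(3) by blast
  have "fraction_on (W \<inter> V) s d F G" "open (W \<inter> V)" "p \<in> W \<inter> V"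
    using W assms(2) p by (auto intro: fraction_on_subset)
  then show "\<exists>W. open W \<and> p \<in> W \<and> W \<subseteq> V \<and> (\<exists>d F G. fraction_on W s d F G)" by blast
qed

text \<open>In a fraction of minimal degree the denominator cannot vanish on \<open>U\<close>: a local presentation
  near such a zero would show that the numerator vanishes there as well, and the common linear
  factor could be cancelled.\<close>

lemma regular_fraction:
  fixes U :: "'k::alg_closed_field proj_line set"
  assumes "open U" "U \<noteq> {}" "regular_on U s"
  obtains d F G where "fraction_on U s d F G" "no_common_zero F G"
proof -
  \<comment> \<open>Only generic agreement with \<open>F / G\<close> is asked for, so that
    cancelling a common linear factor, which may vanish at a point of the chart, again yields such a
    presentation.\<close>
  define rep where "rep d F G \<longleftrightarrow> F \<in> forms d \<and> G \<in> forms d \<and> (\<exists>v. G v \<noteq> 0) \<and>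
    (MOST t. s (point (t, 1)) * G (t, 1) = F (t, 1))" for d F G
  have local: "\<exists>W d F G. open W \<and> p \<in> W \<and> rep d F G \<and> fraction_on W s d F G" if p: "p \<in> U" for p
  proof -
    obtain W d F G where W: "open W" "p \<in> W" "fraction_on W s d F G"
      using regular_onE[OF assms(3) p] by metis
    obtain v where v: "v \<noteq> (0, 0)" "p = point v" by (rule point_cases)
    have "MOST t. point (t, 1) \<in> W" using open_MOST W by blast
    then have "MOST t. s (point (t, 1)) * G (t, 1) = F (t, 1)"
      by eventually_elim (use fraction_onD(3,4)[OF W(3)] in auto)
    then have "rep d F G" using fraction_onD[OF W(3)] W(2) v unfolding rep_def by blast
    then show ?thesis using W by blast
  qed
  define d where "d = (LEAST d. \<exists>F G. rep d F G)"
  have ex: "\<exists>d F G. rep d F G" using local assms(2) by blast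
  obtain F G where FG: "rep d F G" using LeastI_ex[OF ex] unfolding d_def by blast
  have min: "d \<le> d'" if "rep d' F' G'" for d' F' G'
    unfolding d_def using that by (blast intro: Least_le)
  have nz: False if v: "v \<noteq> (0, 0)" "F v = 0" "G v = 0" for v
  proof (cases d)
    case 0
    then obtain c where "G = (\<lambda>_. c)" using FG form_0E unfolding rep_def by blast
    then show False using FG v unfolding rep_def by auto
  next
    case (Suc e)
    have "F \<in> forms (Suc e)" "G \<in> forms (Suc e)" using FG Suc by (auto simp: rep_def)
    then obtain F' G' where F': "F' \<in> forms e" "\<And>w. F w = (snd v * fst w - fst v * snd w) * F' w"
      and G': "G' \<in> forms e" "\<And>w. G w = (snd v * fst w - fst v * snd w) * G' w"
      using form_divide_linear v by metis
    obtain u where u: "G u \<noteq> 0" using FG by (auto simp: rep_def)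
    then have u': "snd v * fst u - fst v * snd u \<noteq> 0" "G' u \<noteq> 0" using G' by auto
    have "MOST t. s (point (t, 1)) * G (t, 1) = F (t, 1)" using FG by (simp add: rep_def)
    moreover have "MOST t. snd v * t - fst v \<noteq> 0"
      using form_nonzero_MOST[OF form_linear u'(1)] by simp
    ultimately have "MOST t. s (point (t, 1)) * G' (t, 1) = F' (t, 1)"
    proof eventually_elim
      case (elim t)
      have "(snd v * t - fst v) * (s (point (t, 1)) * G' (t, 1)) = (snd v * t - fst v) * F' (t, 1)"
        using elim(1) F'(2)[of "(t, 1)"] G'(2)[of "(t, 1)"] by (simp add: mult_ac)
      then show ?case using elim(2) mult_left_cancel by blast
    qed
    then have "rep e F' G'" using F'(1) G'(1) u'(2) unfolding rep_def by blast
    then show False using min Suc by fastforce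
  qed
  have "G v \<noteq> 0 \<and> s (point v) = F v / G v" if v: "v \<noteq> (0, 0)" "point v \<in> U" for v
  proof -
    obtain W e F1 G1 where W: "open W" "point v \<in> W" "rep e F1 G1" "fraction_on W s e F1 G1"
      using local v by metis
    have "MOST t. s (point (t, 1)) * G (t, 1) = F (t, 1)"
      "MOST t. s (point (t, 1)) * G1 (t, 1) = F1 (t, 1)" using FG W by (auto simp: rep_def)
    then have "MOST t. F (t, 1) * G1 (t, 1) = G (t, 1) * F1 (t, 1)"
      by eventually_elim (metis mult.commute mult.left_commute)
    then have eq: "F v * G1 v = G v * F1 v"
      using FG W form_eqI_MOST[OF form_mult form_mult, of F d G1 e G F1] by (auto simp: rep_def)
    have 1: "G1 v \<noteq> 0" "s (point v) = F1 v / G1 v" using fraction_onD[OF W(4)] v W by auto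
    then have "G v \<noteq> 0" using nz[OF v(1)] eq by auto
    then show "G v \<noteq> 0 \<and> s (point v) = F v / G v" using 1 eq by (simp add: frac_eq_eq mult.commute)
  qed
  then have "fraction_on U s d F G" using FG by (intro fraction_onI) (auto simp: rep_def)
  moreover have "no_common_zero F G" using nz unfolding no_common_zero_def by blast
  ultimately show ?thesis by (rule that)
qed

text \<open>Identity theorem: fractions valid on all of \<open>U\<close> reduce the claim to an
  equality of two forms of the same degree, tested at generic points.\<close>

lemma regular_eqI_MOST:
  fixes U :: "'k::alg_closed_field proj_line set"
  assumes "open U" "regular_on U s" "regular_on U t"
    "MOST x. s (point (x, 1)) = t (point (x, 1))" "p \<in> U"
  shows "s p = t p"
proof -
  have U: "U \<noteq> {}" using assms by blast
  obtain v where v: "v \<noteq> (0, 0)" "p = point v" by (rule point_cases)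
  obtain d F G where 1: "fraction_on U s d F G"
    using regular_fraction[OF assms(1) U assms(2)] by metis
  obtain e A B where 2: "fraction_on U t e A B"
    using regular_fraction[OF assms(1) U assms(3)] by metis
  note 1 = fraction_onD[OF 1] and 2 = fraction_onD[OF 2]
  have "F v * B v = G v * A v"
  proof (rule form_eqI_MOST[OF form_mult[OF 1(1) 2(2)] form_mult[OF 1(2) 2(1)]])
    show "MOST x. F (x, 1) * B (x, 1) = G (x, 1) * A (x, 1)"
      using assms(4) open_MOST[OF assms(1) U]
    proof eventually_elim
      case (elim x)
      then show ?case using 1(3,4)[of "(x, 1)"] 2(3,4)[of "(x, 1)"] by (simp add: field_simps)
    qed
  qed
  moreover have "G v \<noteq> 0" "B v \<noteq> 0" "s p = F v / G v" "t p = A v / B v"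
    using 1(3,4)[of v] 2(3,4)[of v] v assms(5) by auto
  ultimately show ?thesis by (simp add: frac_eq_eq mult.commute)
qed

text \<open>Over one denominator all numerators have one degree, which is the shape that
  \<open>forms_independent\<close> requires.\<close>

lemma common_denominator:
  fixes U :: "'k::alg_closed_field proj_line set" and n :: nat
  assumes "open U" "U \<noteq> {}" "\<And>i. i < n \<Longrightarrow> regular_on U (s i)"
  obtains m A H where "\<And>i. i < n \<Longrightarrow> fraction_on U (s i) m (A i) H" "H \<in> forms m"
    "\<And>v. v \<noteq> (0, 0) \<Longrightarrow> point v \<in> U \<Longrightarrow> H v \<noteq> 0"
  using assms(3)
proof (induction n arbitrary: thesis)
  case 0
  show ?case by (rule 0(1)[OF _ form_const[of 1]]) auto
next
  case (Suc n)
  obtain m A H where 1: "\<And>i. i < n \<Longrightarrow> fraction_on U (s i) m (A i) H" "H \<in> forms m"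
    "\<And>v. v \<noteq> (0, 0) \<Longrightarrow> point v \<in> U \<Longrightarrow> H v \<noteq> 0"
    using Suc.IH Suc.prems(2) by (metis less_SucI)
  obtain d F K where "fraction_on U (s n) d F K"
    using regular_fraction[OF assms(1,2) Suc.prems(2)[of n]] by (metis lessI)
  note 2 = fraction_onD[OF this]
  show ?case
  proof (rule Suc.prems(1))
    show "(\<lambda>v. H v * K v) \<in> forms (m + d)" by (rule form_mult[OF 1(2) 2(2)])
    show "H v * K v \<noteq> 0" if "v \<noteq> (0, 0)" "point v \<in> U" for v using 1(3) 2(3) that by simp
    fix i assume i: "i < Suc n"
    show "fraction_on U (s i) (m + d) (if i = n then (\<lambda>v. H v * F v) else (\<lambda>v. A i v * K v)) (\<lambda>v. H v * K v)"
    proof (cases "i = n")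
      case True
      then show ?thesis using 1(2,3) 2 by (simp add: fraction_onI form_mult)
    next
      case False
      then have "i < n" using i by simp
      note 3 = fraction_onD[OF 1(1)[OF this]]
      show ?thesis using 1(3) 2 3 False by (simp add: fraction_onI form_mult)
    qed
  qed
qed

lemma regular_add:
  assumes "regular_on U s" "regular_on U t"
  shows "regular_on U (\<lambda>p. s p + t p)"
  unfolding regular_on_iff
proof
  fix p assume p: "p \<in> U"
  obtain W d F G where W: "open W" "p \<in> W" "W \<subseteq> U" and 1: "fraction_on W s d F G"
    using regular_onE[OF assms(1) p] by blast
  obtain V e A B where V: "open V" "p \<in> V" "V \<subseteq> U" and 2: "fraction_on V t e A B"
    using regular_onE[OF assms(2) p] by blast
  note 1 = fraction_onD[OF 1] and 2 = fraction_onD[OF 2]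
  have "fraction_on (W \<inter> V) (\<lambda>p. s p + t p) (d + e) (\<lambda>v. F v * B v + G v * A v) (\<lambda>v. G v * B v)"
    using 1 2 by (intro fraction_onI form_add form_mult) (auto simp: field_simps)
  then show "\<exists>W. open W \<and> p \<in> W \<and> W \<subseteq> U \<and> (\<exists>d F G. fraction_on W (\<lambda>p. s p + t p) d F G)"
    using W V by (intro exI[of _ "W \<inter> V"]) auto
qed

lemma regular_mult:
  assumes "regular_on U s" "regular_on U t"
  shows "regular_on U (\<lambda>p. s p * t p)"
  unfolding regular_on_iff
proof
  fix p assume p: "p \<in> U"
  obtain W d F G where W: "open W" "p \<in> W" "W \<subseteq> U" and 1: "fraction_on W s d F G"
    using regular_onE[OF assms(1) p] by blast
  obtain V e A B where V: "open V" "p \<in> V" "V \<subseteq> U" and 2: "fraction_on V t e A B"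
    using regular_onE[OF assms(2) p] by blast
  note 1 = fraction_onD[OF 1] and 2 = fraction_onD[OF 2]
  have "fraction_on (W \<inter> V) (\<lambda>p. s p * t p) (d + e) (\<lambda>v. F v * A v) (\<lambda>v. G v * B v)"
    using 1 2 by (intro fraction_onI form_mult) auto
  then show "\<exists>W. open W \<and> p \<in> W \<and> W \<subseteq> U \<and> (\<exists>d F G. fraction_on W (\<lambda>p. s p * t p) d F G)"
    using W V by (intro exI[of _ "W \<inter> V"]) auto
qed

lemma regular_const: "open U \<Longrightarrow> regular_on U (\<lambda>_. c)"
  by (rule regular_onI[OF _ fraction_onI[OF form_const[of c] form_const[of 1]]]) auto

lemma regular_sum:
  assumes "open U" "\<And>i. i \<in> I \<Longrightarrow> regular_on U (s i)"
  shows "regular_on U (\<lambda>p. \<Sum>i\<in>I. s i p)"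
  using assms(2)
  by (induction I rule: infinite_finite_induct) (auto simp: regular_const assms(1) intro: regular_add)

text \<open>\<open>morphism\<close> speaks only of sections that are \<open>undefined\<close>
  outside \<open>U\<close>; restricting first and comparing on the preimage removes this
  encoding.\<close>

lemma regular_compose:
  assumes "morphism f" "open U" "regular_on U s"
  shows "regular_on (f -` U) (\<lambda>q. s (f q))"
proof -
  have "restrict s U \<in> carrier (regular_functions U)"
    using regular_on_cong[OF assms(3)] by (auto simp: regular_functions_def)
  then have "regular_on (f -` U) (pullback f U (restrict s U))"
    using assms(1,2) unfolding morphism_def regular_functions_def by auto
  then show ?thesis by (rule regular_on_cong) (simp add: pullback_def)
qed

lemma open_vimage_morphism: "morphism f \<Longrightarrow> open U \<Longrightarrow> open (f -` U)"
  unfolding morphism_def by (auto simp: continuous_on_open_vimage[OF open_UNIV])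

section \<open>Morphisms in homogeneous coordinates\<close>

definition rep :: "'k::field proj_line \<Rightarrow> 'k \<times> 'k" where
  "rep p = (SOME v. v \<noteq> (0, 0) \<and> point v = p)"

lemma rep: "rep p \<noteq> (0, 0)" "point (rep p) = p"
proof -
  have "\<exists>v. v \<noteq> (0, 0) \<and> point v = p" by (metis point_cases)
  then have "rep p \<noteq> (0, 0) \<and> point (rep p) = p" unfolding rep_def by (rule someI_ex)
  then show "rep p \<noteq> (0, 0)" "point (rep p) = p" by auto
qed

lemma rep_point:
  assumes "v \<noteq> (0, 0)"
  obtains c where "c \<noteq> 0" "rep (point v) = scaled c v"
  using point_eq_iff[OF rep(1) assms, of "point v"] rep(2) by blast

text \<open>A chosen representative vector makes this a total function of the point. For forms of
  equal degree the scaling factors cancel, so the choice does not matter.\<close>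

definition form_quotient :: "('k::field \<times> 'k \<Rightarrow> 'k) \<Rightarrow> ('k \<times> 'k \<Rightarrow> 'k) \<Rightarrow> 'k proj_line \<Rightarrow> 'k" where
  "form_quotient F G p = F (rep p) / G (rep p)"

lemma form_quotient_point:
  assumes "F \<in> forms d" "G \<in> forms d" "v \<noteq> (0, 0)"
  shows "form_quotient F G (point v) = F v / G v"
proof -
  obtain c where "c \<noteq> 0" "rep (point v) = scaled c v" using rep_point[OF assms(3)] by blast
  then show ?thesis
    by (simp add: form_quotient_def form_scaled[OF assms(1)] form_scaled[OF assms(2)])
qed

lemma fraction_on_form_quotient:
  assumes "F \<in> forms d" "G \<in> forms d" "\<And>v. v \<noteq> (0, 0) \<Longrightarrow> point v \<in> U \<Longrightarrow> G v \<noteq> 0"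
  shows "fraction_on U (form_quotient F G) d F G"
  using assms form_quotient_point[OF assms(1,2)] by (intro fraction_onI) auto

definition nonvanishing :: "('k::field \<times> 'k \<Rightarrow> 'k) \<Rightarrow> 'k proj_line set" where
  "nonvanishing F = {p. \<not> vanishes_at F p}"

lemma open_nonvanishing:
  assumes "F \<in> forms d"
  shows "open (nonvanishing F)"
proof -
  have "- nonvanishing F = zero_locus {F}" by (auto simp: zero_locus_def nonvanishing_def)
  then show ?thesis unfolding open_proj_line_def using assms by (intro exI[of _ "{F}"]) auto
qed

lemma point_in_nonvanishing:
  "F \<in> forms d \<Longrightarrow> v \<noteq> (0, 0) \<Longrightarrow> point v \<in> nonvanishing F \<longleftrightarrow> F v \<noteq> 0"
  by (simp add: nonvanishing_def vanishes_at_point)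

lemma regular_form_quotient:
  assumes "F \<in> forms d" "G \<in> forms d"
  shows "regular_on (nonvanishing G) (form_quotient F G)"
  using assms by (intro regular_onI[OF open_nonvanishing[OF assms(2)] fraction_on_form_quotient])
    (auto simp: point_in_nonvanishing simp del: split_paired_All)

lemma point_eqI:
  assumes "v \<noteq> (0, 0)" "w \<noteq> (0, 0)" "snd w * fst v = fst w * snd v"
  shows "point v = point w"
proof (cases "snd w = 0")
  case True
  then have w: "fst w \<noteq> 0" "snd v = 0" using assms by (auto simp: prod_eq_iff)
  then have "fst v \<noteq> 0" using assms(1) by (auto simp: prod_eq_iff)
  then show ?thesis unfolding point_eq_iff[OF assms(1,2)] using w True
    by (intro exI[of _ "fst v / fst w"]) (auto simp: scaled_def prod_eq_iff)
next
  case False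
  then have "snd v \<noteq> 0" using assms by (auto simp: prod_eq_iff)
  then show ?thesis unfolding point_eq_iff[OF assms(1,2)] using False assms(3)
    by (intro exI[of _ "snd v / snd w"]) (auto simp: scaled_def prod_eq_iff field_simps)
qed

text \<open>The coordinate \<open>x / y\<close> of the target pulls back to a regular function whose
  fraction in lowest terms is \<open>P / Q\<close>. This describes \<open>f\<close> only over the
  chart \<open>y \<noteq> 0\<close>; the pullback of \<open>y / x\<close> gives a second fraction
  \<open>P' / Q'\<close>, and \<open>P * P' = Q * Q'\<close> extends the formula to the remaining
  points. Surjectivity makes both preimages nonempty and excludes degree 0, where \<open>f\<close>
  would be constant.\<close>

lemma morphism_homogeneous:
  fixes f :: "'k::alg_closed_field proj_line \<Rightarrow> 'k proj_line"
  assumes "morphism f" "surj f"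
  obtains d P Q where "d > 0" "P \<in> forms d" "Q \<in> forms d" "no_common_zero P Q"
    "\<And>v. v \<noteq> (0, 0) \<Longrightarrow> f (point v) = point (P v, Q v)"
proof -
  define U0 U1 :: "'k proj_line set" where "U0 = nonvanishing snd" and "U1 = nonvanishing fst"
  have U0: "point w \<in> U0 \<longleftrightarrow> snd w \<noteq> 0" and U1: "point w \<in> U1 \<longleftrightarrow> fst w \<noteq> 0" if "w \<noteq> (0, 0)" for w
    using point_in_nonvanishing[OF form_fst that] point_in_nonvanishing[OF form_snd that]
    by (simp_all add: U0_def U1_def)
  have o: "open U0" "open U1"
    unfolding U0_def U1_def by (rule open_nonvanishing[OF form_fst] open_nonvanishing[OF form_snd])+
  have "point (0, 1) \<in> U0" "point (1, 0) \<in> U1" by (simp_all add: U0 U1)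
  then have ne: "f -` U0 \<noteq> {}" "f -` U1 \<noteq> {}" using assms(2) by (metis empty_iff surjD vimageI2)+
  have o': "open (f -` U0)" "open (f -` U1)" using o open_vimage_morphism[OF assms(1)] by auto
  define s0 s1 where "s0 = form_quotient fst (snd :: 'k \<times> 'k \<Rightarrow> 'k)"
    and "s1 = form_quotient snd (fst :: 'k \<times> 'k \<Rightarrow> 'k)"
  have s0: "s0 (point w) = fst w / snd w" and s1: "s1 (point w) = snd w / fst w" if "w \<noteq> (0, 0)" for w
    unfolding s0_def s1_def
    by (rule form_quotient_point[OF form_fst form_snd that] form_quotient_point[OF form_snd form_fst that])+
  have "regular_on U0 s0" "regular_on U1 s1"
    unfolding U0_def U1_def s0_def s1_def
    by (rule regular_form_quotient[OF form_fst form_snd] regular_form_quotient[OF form_snd form_fst])+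
  then have r: "regular_on (f -` U0) (\<lambda>q. s0 (f q))" "regular_on (f -` U1) (\<lambda>q. s1 (f q))"
    using regular_compose[OF assms(1)] o by auto
  obtain d P Q where "fraction_on (f -` U0) (\<lambda>q. s0 (f q)) d P Q" and PQ: "no_common_zero P Q"
    using regular_fraction[OF o'(1) ne(1) r(1)] by blast
  note 0 = fraction_onD[OF this(1)]
  obtain e P' Q' where "fraction_on (f -` U1) (\<lambda>q. s1 (f q)) e P' Q'"
    using regular_fraction[OF o'(2) ne(2) r(2)] by blast
  note 1 = fraction_onD[OF this]
  have eq: "P v * P' v = Q v * Q' v" for v
  proof (rule form_eqI_MOST[OF form_mult[OF 0(1) 1(1)] form_mult[OF 0(2) 1(2)]])
    have "MOST t. point (t, 1) \<in> f -` U0" "MOST t. point (t, 1) \<in> f -` U1"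
      by (rule open_MOST o' ne)+
    then show "MOST t. P (t, 1) * P' (t, 1) = Q (t, 1) * Q' (t, 1)"
    proof eventually_elim
      case (elim t)
      obtain w where w: "w \<noteq> (0, 0)" "f (point (t, 1)) = point w" by (rule point_cases)
      have "fst w \<noteq> 0" "snd w \<noteq> 0" using elim w U0[OF w(1)] U1[OF w(1)] by auto
      then have "s0 (f (point (t, 1))) * s1 (f (point (t, 1))) = 1"
        by (simp add: w(2) s0[OF w(1)] s1[OF w(1)])
      moreover have "P (t, 1) = Q (t, 1) * s0 (f (point (t, 1)))"
        "P' (t, 1) = Q' (t, 1) * s1 (f (point (t, 1)))"
        using 0(3,4)[of "(t, 1)"] 1(3,4)[of "(t, 1)"] elim by auto
      ultimately show ?case by (simp add: mult_ac)
    qed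
  qed
  have f: "f (point v) = point (P v, Q v)" if v: "v \<noteq> (0, 0)" for v
  proof -
    obtain w where w: "w \<noteq> (0, 0)" "f (point v) = point w" by (rule point_cases)
    have PQv: "(P v, Q v) \<noteq> (0, 0)" using PQ v unfolding no_common_zero_def by blast
    have "Q v * fst w = P v * snd w"
    proof (cases "snd w = 0")
      case False
      then have "point v \<in> f -` U0" using w U0[OF w(1)] by simp
      then have "Q v \<noteq> 0" "fst w / snd w = P v / Q v" using 0(3,4)[OF v] s0[OF w(1)] w(2) by auto
      then show ?thesis using False by (simp add: frac_eq_eq mult.commute)
    next
      case True
      \<comment> \<open>The image is the point \<open>(1, 0)\<close>, where the fraction
        \<open>P / Q\<close> says nothing, so \<open>Q v = 0\<close> has to come from the second
        chart.\<close>
      then have "fst w \<noteq> 0" using w(1) by (metis prod.collapse)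
      then have "point v \<in> f -` U1" using w U1[OF w(1)] by simp
      then have "Q' v \<noteq> 0" "snd w / fst w = P' v / Q' v" using 1(3,4)[OF v] s1[OF w(1)] w(2) by auto
      then have "P' v = 0" using True by simp
      then have "Q v = 0" using eq[of v] \<open>Q' v \<noteq> 0\<close> by simp
      then show ?thesis using True by simp
    qed
    then have "point w = point (P v, Q v)" using point_eqI[OF w(1) PQv] by simp
    then show ?thesis using w(2) by simp
  qed
  have "d > 0"
  proof (rule ccontr)
    assume "\<not> d > 0"
    then have "P \<in> forms 0" "Q \<in> forms 0" using 0 by auto
    then obtain a b where "P = (\<lambda>_. a)" "Q = (\<lambda>_. b)" by (metis form_0E)
    then have const: "f p = point (a, b)" for p
      using f by (cases p rule: point_cases) auto
    have "point (0, 1) = point (1, 0 :: 'k)" using const assms(2) by (metis surjD)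
    then show False using U0[of "(0, 1)"] U0[of "(1, 0)"] by simp
  qed
  then show ?thesis using that 0 PQ f by blast
qed

text \<open>Forms of degree \<open>m - 1\<close>, with only the zero form for \<open>m = 0\<close>.
  Truncated subtraction would admit constants there, and their products with linear forms do not
  have degree 0.\<close>

definition lower_forms :: "nat \<Rightarrow> ('k::field \<times> 'k \<Rightarrow> 'k) set" where
  "lower_forms m = (case m of 0 \<Rightarrow> {\<lambda>_. 0} | Suc k \<Rightarrow> forms k)"

lemma lower_forms_mult:
  assumes "S \<in> lower_forms m" "L \<in> forms 1"
  shows "(\<lambda>v. S v * L v) \<in> forms m"
  using assms form_mult[of S "m - 1" L 1] by (auto simp: lower_forms_def form_zero split: nat.splits)

section \<open>A surjective morphism given by \<open>P\<close> and \<open>Q\<close>\<close>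

locale line_map = two_forms P Q d G
  for P Q :: "'a::alg_closed_field \<times> 'a \<Rightarrow> 'a" and d G +
  fixes f :: "'a::alg_closed_field proj_line \<Rightarrow> 'a proj_line"
  assumes morphism: "morphism f" and surj: "surj f"
    and f_point: "v \<noteq> (0, 0) \<Longrightarrow> f (point v) = point (P v, Q v)"
begin

lemma PQ_nonzero: "v \<noteq> (0, 0) \<Longrightarrow> (P v, Q v) \<noteq> (0, 0)"
  using PQ unfolding no_common_zero_def by blast

lemma Q_nonzero: obtains v where "v \<noteq> (0, 0)" "Q v \<noteq> 0"
proof -
  obtain v where v: "v \<noteq> (0, 0)" "P v = 0" using form_has_zero[OF P d] by auto
  then show ?thesis using PQ that unfolding no_common_zero_def by blast
qed

lemma open_vimage: "open U \<Longrightarrow> open (f -` U)"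
  by (rule open_vimage_morphism[OF morphism])

lemma vimage_nonempty: "U \<noteq> {} \<Longrightarrow> f -` U \<noteq> {}"
  using surj by (metis all_not_in_conv surjD vimageI2)

text \<open>\<open>H\<close> plays the role of the norm of \<open>B\<close>: it is the product of the linear forms vanishing at the
  images of the zeros of \<open>B\<close>.\<close>

lemma denominator_pullback:
  assumes "B \<in> forms e" "\<And>v. v \<noteq> (0, 0) \<Longrightarrow> f (point v) \<in> U \<Longrightarrow> B v \<noteq> 0"
  obtains H C where "H \<in> forms e" "C \<in> forms (e * (d - 1))"
    "\<And>w. w \<noteq> (0, 0) \<Longrightarrow> point w \<in> U \<Longrightarrow> H w \<noteq> 0" "\<And>v. H (P v, Q v) = B v * C v"
    "(\<exists>v. B v \<noteq> 0) \<Longrightarrow> (\<exists>w. H w \<noteq> 0)"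
  using assms
proof (induction e arbitrary: B thesis)
  case 0
  obtain c where B: "B = (\<lambda>_. c)" using form_0E 0 by blast
  \<comment> \<open>Surjectivity transfers the condition from the preimage to \<open>U\<close>: as
    soon as \<open>U\<close> has a point, the constant is nonzero.\<close>
  have "c \<noteq> 0" if "w \<in> U" for w
  proof -
    obtain p where "f p = w" using surj by (metis surjD)
    moreover obtain v where "v \<noteq> (0, 0)" "p = point v" by (rule point_cases)
    ultimately show ?thesis using 0(3)[of v] B that by simp
  qed
  then show ?case using 0(2) by (intro 0(1)[of B "\<lambda>_. 1"]) (auto simp: B form_const)
next
  case (Suc e)
  obtain v where v: "v \<noteq> (0, 0)" "B v = 0" using form_has_zero[OF Suc.prems(2)] by auto
  define w where "w = (P v, Q v)"
  have w: "w \<noteq> (0, 0)" using PQ_nonzero[OF v(1)] by (simp add: w_def)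
  have wU: "point w \<notin> U" using Suc.prems(3)[OF v(1)] v f_point by (auto simp: w_def)
  obtain B' where B': "B' \<in> forms e" "\<And>u. B u = (snd v * fst u - fst v * snd u) * B' u"
    using form_divide_linear[OF Suc.prems(2) v(2,1)] by blast
  have "B' u \<noteq> 0" if "u \<noteq> (0, 0)" "f (point u) \<in> U" for u using Suc.prems(3)[OF that] B'(2) by auto
  then obtain H' C' where HC': "H' \<in> forms e" "C' \<in> forms (e * (d - 1))"
    "\<And>w. w \<noteq> (0, 0) \<Longrightarrow> point w \<in> U \<Longrightarrow> H' w \<noteq> 0" "\<And>v. H' (P v, Q v) = B' v * C' v"
    "(\<exists>v. B' v \<noteq> 0) \<Longrightarrow> (\<exists>w. H' w \<noteq> 0)"
    using Suc.IH[OF _ B'(1)] by blast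
  define L where "L u = snd w * fst u - fst w * snd u" for u
  have L: "L \<in> forms 1" unfolding L_def[abs_def] by (rule form_linear)
  have L0: "\<exists>u. L u \<noteq> 0"
  proof (cases "snd w = 0")
    case True
    then show ?thesis using w by (intro exI[of _ "(0, 1)"]) (auto simp: L_def prod_eq_iff)
  next
    case False
    then show ?thesis by (intro exI[of _ "(1, 0)"]) (auto simp: L_def)
  qed
  \<comment> \<open>\<open>L\<close> vanishes at the image \<open>w\<close> of \<open>v\<close>, so
    \<open>L (P, Q)\<close> vanishes at \<open>v\<close>; its linear factor there matches the one
    taken from \<open>B\<close>.\<close>
  have "(\<lambda>u. L (P u, Q u)) \<in> forms (Suc (d - 1))" using form_compose[OF L P Q] d by simp
  moreover have "L (P v, Q v) = 0" by (simp add: L_def w_def mult.commute)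
  ultimately obtain C1 where C1: "C1 \<in> forms (d - 1)"
      "\<And>u. L (P u, Q u) = (snd v * fst u - fst v * snd u) * C1 u"
    using form_divide_linear v(1) by blast
  show ?case
  proof (rule Suc.prems(1))
    show "(\<lambda>u. L u * H' u) \<in> forms (Suc e)" using form_mult[OF L HC'(1)] by simp
    show "(\<lambda>u. C1 u * C' u) \<in> forms (Suc e * (d - 1))" using form_mult[OF C1(1) HC'(2)] by simp
    show "L u * H' u \<noteq> 0" if u: "u \<noteq> (0, 0)" "point u \<in> U" for u
    proof -
      have "L u \<noteq> 0" using point_eqI[OF u(1) w] wU u(2) by (auto simp: L_def)
      then show ?thesis using HC'(3)[OF u] by simp
    qed
    \<comment> \<open>For empty \<open>U\<close> the pointwise condition says nothing, and this
      clause alone keeps \<open>H\<close> from being the zero form; \<open>field_degree\<close>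
      relies on it.\<close>
    show "\<exists>u. L u * H' u \<noteq> 0" if nzB: "\<exists>u. B u \<noteq> 0"
    proof -
      obtain x where "H' x \<noteq> 0" using nzB HC'(5) B'(2) by (metis mult_zero_right)
      moreover obtain y where "L y \<noteq> 0" using L0 by blast
      ultimately have "MOST t. H' (t, 1) \<noteq> 0" "MOST t. L (t, 1) \<noteq> 0"
        using form_nonzero_MOST HC'(1) L by blast+
      then have "MOST t. L (t, 1) * H' (t, 1) \<noteq> 0" by eventually_elim simp
      then show ?thesis by (blast dest: MOST_imp_ex)
    qed
    show "L (P u, Q u) * H' (P u, Q u) = B u * (C1 u * C' u)" for u
      by (simp add: C1(2) HC'(4) B'(2) mult_ac)
  qed
qed

text \<open>Extending \<open>h = A / B\<close> by the cofactor \<open>C\<close> with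
  \<open>B * C = H (P, Q)\<close> gives a numerator \<open>A * C\<close> of degree
  \<open>m * d\<close>, to which \<open>forms_span_Suc\<close> applies. For \<open>m = 0\<close> the
  numerator is a constant and every \<open>S i\<close> is zero.\<close>

lemma regular_vimage_decompose:
  assumes "open U" "U \<noteq> {}" "regular_on (f -` U) h"
  obtains m H R S where "H \<in> forms m" "\<And>w. w \<noteq> (0, 0) \<Longrightarrow> point w \<in> U \<Longrightarrow> H w \<noteq> 0"
    "R \<in> forms m" "\<And>i. S i \<in> lower_forms m"
    "\<And>v. v \<noteq> (0, 0) \<Longrightarrow> f (point v) \<in> U \<Longrightarrow>
      h (point v) = (R (P v, Q v) + (\<Sum>i<d - 1. S i (P v, Q v) * G (Suc i) v)) / H (P v, Q v)"
proof -
  obtain m A B where "fraction_on (f -` U) h m A B"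
    using regular_fraction[OF open_vimage vimage_nonempty] assms by metis
  note AB = fraction_onD[OF this]
  obtain H C where HC: "H \<in> forms m" "C \<in> forms (m * (d - 1))"
    "\<And>w. w \<noteq> (0, 0) \<Longrightarrow> point w \<in> U \<Longrightarrow> H w \<noteq> 0" "\<And>v. H (P v, Q v) = B v * C v"
    using denominator_pullback[OF AB(2), of U] AB(3) by (metis vimageI2)
  have "m + m * (d - 1) = m * d" using d by (cases d) auto
  then have AC: "(\<lambda>v. A v * C v) \<in> forms (m * d)" using form_mult[OF AB(1) HC(2)] by simp
  obtain R S where RS: "R \<in> forms m" "\<And>i. S i \<in> lower_forms m"
    "\<And>v. A v * C v = R (P v, Q v) + (\<Sum>i<d - 1. S i (P v, Q v) * G (Suc i) v)"
  proof (cases m)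
    case 0
    then obtain c where "(\<lambda>v. A v * C v) = (\<lambda>_. c)" using AC form_0E by (metis mult_0)
    then have "A v * C v = c" for v by metis
    then show ?thesis using 0 by (intro that[of "\<lambda>_. c" "\<lambda>_ _. 0"]) (auto simp: form_const lower_forms_def)
  next
    case (Suc k)
    obtain R S where "R \<in> forms (Suc k)" "\<And>i. S i \<in> forms k"
      "\<And>v. A v * C v = R (P v, Q v) + (\<Sum>i<d - 1. S i (P v, Q v) * G (Suc i) v)"
      using forms_span_Suc[of _ k] AC unfolding Suc by blast
    then show ?thesis using that[of R S] by (simp add: Suc lower_forms_def)
  qed
  show ?thesis
  proof (rule that[OF HC(1,3) RS(1,2)])
    fix v assume v: "v \<noteq> (0, 0)" "f (point v) \<in> U"
    have "H (P v, Q v) \<noteq> 0" using HC(3) PQ_nonzero f_point v by metis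
    moreover have "h (point v) = A v / B v" using AB(4) v by simp
    ultimately show "h (point v) = (R (P v, Q v) + (\<Sum>i<d - 1. S i (P v, Q v) * G (Suc i) v)) / H (P v, Q v)"
      unfolding RS(3)[symmetric] by (simp add: HC(4))
  qed
qed

text \<open>Clearing a common denominator and \<open>Q\<close> turns the relation into one between
  the forms \<open>A i (P, Q) * G i\<close>, valid at generic points and hence identically. The
  result serves twice: for the degree of the field extension and for injectivity of the sheaf
  map.\<close>

lemma regular_independent:
  assumes "open U" "\<And>i. i < d \<Longrightarrow> regular_on U (s i)"
    "\<And>v. v \<noteq> (0, 0) \<Longrightarrow> f (point v) \<in> U \<Longrightarrow> Q v \<noteq> 0 \<Longrightarrow> (\<Sum>i<d. s i (f (point v)) * (G i v / Q v)) = 0"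
    "i < d" "p \<in> U"
  shows "s i p = 0"
proof -
  have U: "U \<noteq> {}" using assms(5) by blast
  obtain m A H where AH: "\<And>i. i < d \<Longrightarrow> fraction_on U (s i) m (A i) H" "H \<in> forms m"
    "\<And>v. v \<noteq> (0, 0) \<Longrightarrow> point v \<in> U \<Longrightarrow> H v \<noteq> 0"
    using common_denominator[OF assms(1) U, of d s] assms(2) by blast
  note A = fraction_onD[OF AH(1)]
  obtain u where u: "Q u \<noteq> 0" by (rule Q_nonzero)
  have "A i w = 0" if "i < d" for i w
  proof (rule forms_independent[OF A(1) _ that])
    fix v
    show "(\<Sum>i<d. A i (P v, Q v) * G i v) = 0"
    proof (rule form_eqI_MOST[OF _ form_zero])
      show "(\<lambda>v. \<Sum>i<d. A i (P v, Q v) * G i v) \<in> forms (m * d + d)"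
        using A(1) G by (intro form_sum form_mult[OF form_compose[OF _ P Q]]) auto
      show "MOST t. (\<Sum>i<d. A i (P (t, 1), Q (t, 1)) * G i (t, 1)) = 0"
        using form_nonzero_MOST[OF Q u] open_MOST[OF open_vimage[OF assms(1)] vimage_nonempty[OF U]]
      proof eventually_elim
        case (elim t)
        define v where "v = (t, 1::'a)"
        have v: "v \<noteq> (0, 0)" "f (point v) \<in> U" "Q v \<noteq> 0" using elim by (auto simp: v_def)
        then have pU: "point (P v, Q v) \<in> U" by (simp add: f_point)
        then have Hv: "H (P v, Q v) \<noteq> 0" using AH(3) PQ_nonzero v by metis
        have "0 = (\<Sum>i<d. s i (f (point v)) * (G i v / Q v))" using assms(3) v by simp
        also have "\<dots> = (\<Sum>i<d. A i (P v, Q v) * G i v) / (H (P v, Q v) * Q v)"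
          unfolding sum_divide_distrib
          by (rule sum.cong) (use A(4) PQ_nonzero[OF v(1)] pU v in \<open>auto simp: f_point\<close>)
        finally show ?case using Hv v(3) by (simp add: v_def)
      qed
    qed
  qed
  moreover obtain w where "w \<noteq> (0, 0)" "p = point w" by (rule point_cases)
  ultimately show ?thesis using A(4)[OF assms(4), of w] assms(4,5) by simp
qed

end

section \<open>The function field\<close>

text \<open>Representatives of rational functions freed from being \<open>undefined\<close> outside
  \<open>U\<close>; \<open>rat_class\<close> does not distinguish a function from its
  restriction.\<close>

definition rational :: "'k::field proj_line set \<Rightarrow> ('k proj_line \<Rightarrow> 'k) \<Rightarrow> bool" where
  "rational U s \<longleftrightarrow> open U \<and> U \<noteq> {} \<and> regular_on U s"

lemma rational_restrict: "rational U s \<longleftrightarrow> rational U (restrict s U)"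
  unfolding rational_def by (auto intro: regular_on_cong)

lemma rat_class_restrict: "rat_class U (restrict s U) = rat_class U s"
  by (auto simp: rat_class_def)

lemma rational_Int:
  fixes U :: "'k::alg_closed_field proj_line set"
  assumes "rational U s" "rational V t"
  shows "open (U \<inter> V)" "U \<inter> V \<noteq> {}" "regular_on (U \<inter> V) s" "regular_on (U \<inter> V) t"
  using assms open_Int_nonempty unfolding rational_def
  by (auto intro: regular_on_subset simp del: disjoint_iff)

lemma rational_add:
  fixes U :: "'k::alg_closed_field proj_line set"
  assumes "rational U s" "rational V t"
  shows "rational (U \<inter> V) (\<lambda>p. s p + t p)"
  unfolding rational_def using rational_Int[OF assms] by (blast intro: regular_add)

lemma rational_mult:
  fixes U :: "'k::alg_closed_field proj_line set"
  assumes "rational U s" "rational V t"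
  shows "rational (U \<inter> V) (\<lambda>p. s p * t p)"
  unfolding rational_def using rational_Int[OF assms] by (blast intro: regular_mult)

lemma rational_const: "rational UNIV (\<lambda>_. c)"
  by (simp add: rational_def regular_const)

lemma carrier_function_field:
  "carrier function_field = {rat_class U s | U s. rational U s}"
proof -
  have "\<exists>U' s'. rat_class U s = rat_class U' s' \<and> open U' \<and> U' \<noteq> {} \<and> s' \<in> carrier (regular_functions U')"
    if "rational U s" for U :: "'a proj_line set" and s
    using that rational_restrict[of U s]
    by (intro exI[of _ U] exI[of _ "restrict s U"]) (auto simp: rat_class_restrict rational_def regular_functions_def)
  then show ?thesis
    unfolding function_field_def by (fastforce simp: rational_def regular_functions_def)
qed

lemma function_field_cases:
  assumes "A \<in> carrier function_field"
  obtains U s where "rational U s" "A = rat_class U s"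
  using assms by (auto simp: carrier_function_field)

lemma rat_class_mem: "(V, t) \<in> rat_class U s \<Longrightarrow> rational V t"
  by (auto simp: rat_class_def rational_def regular_functions_def)

lemma rat_class_self: "rational U s \<Longrightarrow> (U, restrict s U) \<in> rat_class U s"
  using rational_restrict[of U s] by (auto simp: rat_class_def rational_def regular_functions_def)

text \<open>Agreement on an overlap is not visibly transitive, agreement at almost all
  \<open>(x, 1)\<close> is. The identity theorem makes them equivalent, so classes are compared at
  generic points whatever their domains.\<close>

lemma MOST_agree:
  fixes U :: "'k::alg_closed_field proj_line set"
  assumes "rational U s" "rational V t"
  shows "(\<forall>p\<in>U \<inter> V. s p = t p) \<longleftrightarrow> (MOST x. s (point (x, 1)) = t (point (x, 1)))"
proof
  assume *: "\<forall>p\<in>U \<inter> V. s p = t p"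
  show "MOST x. s (point (x, 1)) = t (point (x, 1))"
    using open_MOST[OF rational_Int(1,2)[OF assms]] by eventually_elim (use * in blast)
next
  assume "MOST x. s (point (x, 1)) = t (point (x, 1))"
  then show "\<forall>p\<in>U \<inter> V. s p = t p"
    using regular_eqI_MOST[OF rational_Int(1,3,4)[OF assms]] by blast
qed

lemma rat_class_mem_MOST:
  fixes U :: "'k::alg_closed_field proj_line set"
  assumes "rational U s" "(V, t) \<in> rat_class U s"
  shows "MOST x. s (point (x, 1)) = t (point (x, 1))"
  using MOST_agree[OF assms(1) rat_class_mem[OF assms(2)]] assms(2) by (auto simp: rat_class_def)

lemma rat_class_eq_iff:
  fixes U :: "'k::alg_closed_field proj_line set"
  assumes "rational U s" "rational V t"
  shows "rat_class U s = rat_class V t \<longleftrightarrow> (MOST x. s (point (x, 1)) = t (point (x, 1)))"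
proof
  assume "rat_class U s = rat_class V t"
  then have "(V, restrict t V) \<in> rat_class U s" using rat_class_self[OF assms(2)] by simp
  then have "\<forall>p\<in>U \<inter> V. s p = t p" by (auto simp: rat_class_def)
  then show "MOST x. s (point (x, 1)) = t (point (x, 1))" using MOST_agree[OF assms] by simp
next
  assume eq: "MOST x. s (point (x, 1)) = t (point (x, 1))"
  have "(\<forall>p\<in>U \<inter> W. s p = r p) \<longleftrightarrow> (\<forall>p\<in>V \<inter> W. t p = r p)" if "rational W r" for W r
    unfolding MOST_agree[OF assms(1) that] MOST_agree[OF assms(2) that]
    using eq by (auto elim: eventually_elim2)
  then show "rat_class U s = rat_class V t"
    unfolding rat_class_def by (auto simp: rational_def regular_functions_def)
qed

text \<open>The field operations are defined as unions over all pairs of representatives. All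
  classes in such a union coincide and the family is nonempty, so the union collapses to one
  class.\<close>

lemma rat_class_binary:
  fixes U :: "'k::alg_closed_field proj_line set"
  assumes U: "rational U s" and V: "rational V t"
    and op: "\<And>W s' t'. regular_on W s' \<Longrightarrow> regular_on W t' \<Longrightarrow> regular_on W (\<lambda>p. op (s' p) (t' p))"
  shows "(\<Union>(U', s') \<in> rat_class U s. \<Union>(V', t') \<in> rat_class V t.
      rat_class (U' \<inter> V') (\<lambda>p \<in> U' \<inter> V'. op (s' p) (t' p))) = rat_class (U \<inter> V) (\<lambda>p. op (s p) (t p))"
proof -
  have rat: "rational (U' \<inter> V') (\<lambda>p. op (s' p) (t' p))" if "rational U' s'" "rational V' t'"
    for U' V' :: "'k proj_line set" and s' t'
    using rational_Int[OF that] op by (simp add: rational_def)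
  have "rat_class (U' \<inter> V') (\<lambda>p \<in> U' \<inter> V'. op (s' p) (t' p)) = rat_class (U \<inter> V) (\<lambda>p. op (s p) (t p))"
    if U': "(U', s') \<in> rat_class U s" and V': "(V', t') \<in> rat_class V t" for U' s' V' t'
  proof -
    have "MOST x. op (s' (point (x, 1))) (t' (point (x, 1))) = op (s (point (x, 1))) (t (point (x, 1)))"
      using rat_class_mem_MOST[OF U U'] rat_class_mem_MOST[OF V V'] by eventually_elim simp
    then show ?thesis
      unfolding rat_class_restrict
      using rat_class_eq_iff[OF rat[OF rat_class_mem[OF U'] rat_class_mem[OF V']] rat[OF U V]] by simp
  qed
  then have "(\<Union>(U', s') \<in> rat_class U s. \<Union>(V', t') \<in> rat_class V t.
      rat_class (U' \<inter> V') (\<lambda>p \<in> U' \<inter> V'. op (s' p) (t' p))) =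
    (\<Union>(U', s') \<in> rat_class U s. \<Union>(V', t') \<in> rat_class V t. rat_class (U \<inter> V) (\<lambda>p. op (s p) (t p)))"
    by (intro SUP_cong refl) auto
  also have "\<dots> = rat_class (U \<inter> V) (\<lambda>p. op (s p) (t p))"
    using rat_class_self[OF U] rat_class_self[OF V] by auto
  finally show ?thesis .
qed

lemma rat_class_add:
  fixes U :: "'k::alg_closed_field proj_line set"
  shows "rational U s \<Longrightarrow> rational V t \<Longrightarrow>
    rat_class U s \<oplus>\<^bsub>function_field\<^esub> rat_class V t = rat_class (U \<inter> V) (\<lambda>p. s p + t p)"
  unfolding function_field_def ring_record_simps by (rule rat_class_binary) (auto intro: regular_add)

lemma rat_class_mult:
  fixes U :: "'k::alg_closed_field proj_line set"
  shows "rational U s \<Longrightarrow> rational V t \<Longrightarrow>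
    rat_class U s \<otimes>\<^bsub>function_field\<^esub> rat_class V t = rat_class (U \<inter> V) (\<lambda>p. s p * t p)"
  unfolding function_field_def monoid.simps by (rule rat_class_binary) (auto intro: regular_mult)

lemma function_field_zero: "\<zero>\<^bsub>function_field\<^esub> = rat_class UNIV (\<lambda>_. 0)"
  by (simp add: function_field_def)

lemma rat_class_eq_zero_iff:
  fixes U :: "'k::alg_closed_field proj_line set"
  assumes "rational U s"
  shows "rat_class U s = \<zero>\<^bsub>function_field\<^esub> \<longleftrightarrow> (\<forall>p\<in>U. s p = 0)"
  using rat_class_eq_iff[OF assms rational_const] MOST_agree[OF assms rational_const]
  by (simp add: function_field_zero)

lemma function_field_one: "\<one>\<^bsub>function_field\<^esub> = rat_class UNIV (\<lambda>_. 1)"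
  by (simp add: function_field_def)

lemma rat_class_in_carrier: "rational U s \<Longrightarrow> rat_class U s \<in> carrier function_field"
  by (auto simp: carrier_function_field)

lemma rat_class_eqI:
  fixes U :: "'k::alg_closed_field proj_line set"
  assumes "rational U s" "rational V t" "\<And>p. s p = t p"
  shows "rat_class U s = rat_class V t"
  using rat_class_eq_iff[OF assms(1,2)] assms(3) by simp

lemmas rational_intros = rational_add rational_mult rational_const

section \<open>The field structure\<close>

lemma cring_function_field:
  "cring (function_field :: ('k::alg_closed_field proj_line set \<times> ('k proj_line \<Rightarrow> 'k)) set ring)"
proof (rule cringI)
  show "abelian_group (function_field :: ('k proj_line set \<times> ('k proj_line \<Rightarrow> 'k)) set ring)"
  proof (rule abelian_groupI, goal_cases)
    case (6 x)
    then obtain U s where s: "rational U s" "x = rat_class U s" by (rule function_field_cases)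
    have m: "rational (UNIV \<inter> U) (\<lambda>p. -1 * s p)" by (rule rational_mult[OF rational_const s(1)])
    show ?case unfolding s(2) function_field_zero
    proof (rule bexI[OF _ rat_class_in_carrier[OF m]])
      show "rat_class (UNIV \<inter> U) (\<lambda>p. -1 * s p) \<oplus>\<^bsub>function_field\<^esub> rat_class U s = rat_class UNIV (\<lambda>_. 0)"
        unfolding rat_class_add[OF m s(1)]
        by (rule rat_class_eqI[OF rational_add[OF m s(1)] rational_const]) simp
    qed
  qed (auto elim!: function_field_cases simp: function_field_zero rat_class_add rational_intros add_ac Int_ac
      intro!: rat_class_in_carrier)
  show "comm_monoid (function_field :: ('k proj_line set \<times> ('k proj_line \<Rightarrow> 'k)) set ring)"
    by (rule comm_monoidI) (auto elim!: function_field_cases simp: function_field_one rat_class_mult rational_intros mult_ac Int_ac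
      intro!: rat_class_in_carrier)
next
  fix x y z :: "('k proj_line set \<times> ('k proj_line \<Rightarrow> 'k)) set"
  assume "x \<in> carrier function_field" "y \<in> carrier function_field" "z \<in> carrier function_field"
  then obtain U s V t W r where r: "rational U s" "rational V t" "rational W r"
    and "x = rat_class U s" "y = rat_class V t" "z = rat_class W r" by (metis function_field_cases)
  then show "(x \<oplus>\<^bsub>function_field\<^esub> y) \<otimes>\<^bsub>function_field\<^esub> z =
      x \<otimes>\<^bsub>function_field\<^esub> z \<oplus>\<^bsub>function_field\<^esub> y \<otimes>\<^bsub>function_field\<^esub> z"
    by (simp add: rat_class_add rat_class_mult rational_intros distrib_right Int_ac)
qed

lemma field_function_field:
  "field (function_field :: ('k::alg_closed_field proj_line set \<times> ('k proj_line \<Rightarrow> 'k)) set ring)"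
proof (rule cring.cring_fieldI2[OF cring_function_field])
  show "\<zero>\<^bsub>function_field\<^esub> \<noteq> (\<one>\<^bsub>function_field\<^esub> :: ('k proj_line set \<times> ('k proj_line \<Rightarrow> 'k)) set)"
  proof
    assume "\<zero>\<^bsub>function_field\<^esub> = (\<one>\<^bsub>function_field\<^esub> :: ('k proj_line set \<times> ('k proj_line \<Rightarrow> 'k)) set)"
    then have "MOST x::'k. (0::'k) = 1"
      unfolding function_field_zero function_field_one rat_class_eq_iff[OF rational_const rational_const] .
    then have "(0::'k) = 1" by (rule MOST_not_const)
    then show False by simp
  qed
next
  fix a :: "('k proj_line set \<times> ('k proj_line \<Rightarrow> 'k)) set"
  assume "a \<in> carrier function_field" and nz: "a \<noteq> \<zero>\<^bsub>function_field\<^esub>"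
  then obtain U s where s: "rational U s" "a = rat_class U s" by (metis function_field_cases)
  then have U: "open U" "U \<noteq> {}" by (auto simp: rational_def)
  obtain e F H where "fraction_on U s e F H"
    using regular_fraction[OF U] s(1) unfolding rational_def by metis
  note F = fraction_onD[OF this]
  have "\<exists>v. v \<noteq> (0, 0) \<and> F v \<noteq> 0"
  proof (rule ccontr)
    assume "\<not> ?thesis"
    then have *: "F v = 0" if "v \<noteq> (0, 0)" for v using that by blast
    have "MOST x. s (point (x, 1)) = 0"
      using open_MOST[OF U]
    proof eventually_elim
      case (elim x)
      have "F (x, 1) = 0" using *[of "(x, 1)"] by simp
      then show ?case using F(4)[of "(x, 1)"] elim by simp
    qed
    then show False using nz s rat_class_eq_iff[OF s(1) rational_const] by (simp add: function_field_zero)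
  qed
  then obtain v where v: "v \<noteq> (0, 0)" "F v \<noteq> 0" by blast
  \<comment> \<open>The inverse exchanges numerator and denominator; its domain is nonempty because
    \<open>F\<close> is not the zero form.\<close>
  have r: "rational (nonvanishing F) (form_quotient H F)"
    using regular_form_quotient[OF F(2,1)] open_nonvanishing[OF F(1)] point_in_nonvanishing[OF F(1) v(1)] v(2)
    by (auto simp: rational_def)
  have "MOST x. s (point (x, 1)) * form_quotient H F (point (x, 1)) = 1"
    using open_MOST[OF U] form_nonzero_MOST[OF F(1) v(2)]
  proof eventually_elim
    case (elim x)
    then show ?case
      using F(3,4)[of "(x, 1)"] form_quotient_point[OF F(2,1), of "(x, 1)"] by simp
  qed
  then have "a \<otimes>\<^bsub>function_field\<^esub> rat_class (nonvanishing F) (form_quotient H F) = \<one>\<^bsub>function_field\<^esub>"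
    unfolding s(2) rat_class_mult[OF s(1) r] function_field_one
      rat_class_eq_iff[OF rational_mult[OF s(1) r] rational_const] .
  then show "\<exists>b\<in>carrier function_field. a \<otimes>\<^bsub>function_field\<^esub> b = \<one>\<^bsub>function_field\<^esub>"
    using rat_class_in_carrier[OF r] by blast
qed

section \<open>Pullback of rational functions and linear combinations\<close>

lemma rational_subset:
  "rational U s \<Longrightarrow> open V \<Longrightarrow> V \<noteq> {} \<Longrightarrow> V \<subseteq> U \<Longrightarrow> rational V s"
  unfolding rational_def by (blast intro: regular_on_subset)

lemma rat_class_subset:
  fixes U :: "'k::alg_closed_field proj_line set"
  assumes "rational U s" "open V" "V \<noteq> {}" "V \<subseteq> U"
  shows "rat_class U s = rat_class V s"
  by (rule rat_class_eqI[OF assms(1) rational_subset[OF assms]]) simp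

lemma rational_vimage:
  assumes "morphism f" "surj f" "rational U s"
  shows "rational (f -` U) (\<lambda>q. s (f q))"
proof -
  have "f -` U \<noteq> {}" using assms(2,3) unfolding rational_def by (metis all_not_in_conv surjD vimageI2)
  then show ?thesis
    using assms regular_compose open_vimage_morphism unfolding rational_def by blast
qed

text \<open>As with the field operations, the union over representatives collapses. Surjectivity
  keeps the preimages of their domains nonempty.\<close>

lemma function_field_pullback:
  fixes U :: "'k::alg_closed_field proj_line set"
  assumes f: "morphism f" "surj f" and U: "rational U s"
  shows "function_field_pullback f (rat_class U s) = rat_class (f -` U) (\<lambda>q. s (f q))"
proof -
  have "rat_class (f -` V) (pullback f V t) = rat_class (f -` U) (\<lambda>q. s (f q))"
    if V: "(V, t) \<in> rat_class U s" for V t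
  proof -
    have V': "rational V t" by (rule rat_class_mem[OF V])
    have rV: "rational (f -` V) (\<lambda>q. t (f q))" and rU: "rational (f -` U) (\<lambda>q. s (f q))"
      by (rule rational_vimage[OF f] V' U)+
    have "\<forall>p\<in>f -` V \<inter> f -` U. t (f p) = s (f p)" using V by (auto simp: rat_class_def)
    then have "rat_class (f -` V) (\<lambda>q. t (f q)) = rat_class (f -` U) (\<lambda>q. s (f q))"
      using MOST_agree[OF rV rU] rat_class_eq_iff[OF rV rU] by simp
    then show ?thesis by (simp add: pullback_def rat_class_restrict)
  qed
  then have "function_field_pullback f (rat_class U s) = (\<Union>(V, t) \<in> rat_class U s. rat_class (f -` U) (\<lambda>q. s (f q)))"
    unfolding function_field_pullback_def by (intro SUP_cong refl) auto
  also have "\<dots> = rat_class (f -` U) (\<lambda>q. s (f q))" using rat_class_self[OF U] by auto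
  finally show ?thesis .
qed

lemma function_field_pullback_hom:
  fixes f :: "'k::alg_closed_field proj_line \<Rightarrow> 'k proj_line"
  assumes f: "morphism f" "surj f"
  shows "function_field_pullback f \<in> ring_hom function_field function_field"
proof (rule ring_hom_memI)
  show "function_field_pullback f x \<in> carrier function_field" if "x \<in> carrier function_field" for x
    using that by (auto elim!: function_field_cases
        simp: function_field_pullback[OF f] intro!: rat_class_in_carrier rational_vimage f)
  fix x y :: "('k proj_line set \<times> ('k proj_line \<Rightarrow> 'k)) set"
  assume "x \<in> carrier function_field" "y \<in> carrier function_field"
  then obtain U s V t where r: "rational U s" "rational V t"
    and xy: "x = rat_class U s" "y = rat_class V t" by (metis function_field_cases)
  note v = rational_vimage[OF f r(1)] rational_vimage[OF f r(2)]
  show "function_field_pullback f (x \<otimes>\<^bsub>function_field\<^esub> y) =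
      function_field_pullback f x \<otimes>\<^bsub>function_field\<^esub> function_field_pullback f y"
    unfolding xy by (simp add: r v function_field_pullback[OF f] rat_class_mult rational_mult)
  show "function_field_pullback f (x \<oplus>\<^bsub>function_field\<^esub> y) =
      function_field_pullback f x \<oplus>\<^bsub>function_field\<^esub> function_field_pullback f y"
    unfolding xy by (simp add: r v function_field_pullback[OF f] rat_class_add rational_add)
next
  show "function_field_pullback f \<one>\<^bsub>function_field\<^esub> = \<one>\<^bsub>function_field\<^esub>"
    by (simp add: function_field_one function_field_pullback[OF f] rational_const)
qed

lemma subfield_pullback:
  fixes f :: "'k::alg_closed_field proj_line \<Rightarrow> 'k proj_line"
  assumes f: "morphism f" "surj f"
  shows "subfield (function_field_pullback f ` carrier function_field) function_field"
proof -
  interpret field "function_field :: ('k proj_line set \<times> ('k proj_line \<Rightarrow> 'k)) set ring"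
    by (rule field_function_field)
  interpret ring_hom_ring function_field "function_field :: ('k proj_line set \<times> ('k proj_line \<Rightarrow> 'k)) set ring"
      "function_field_pullback f"
    by (rule ring_hom_ringI2[OF ring_axioms ring_axioms function_field_pullback_hom[OF f]])
  show ?thesis by (rule img_is_subfield(2)[OF carrier_is_subfield]) simp
qed

lemma regular_lincomb:
  assumes "open W" "\<And>i. i \<in> set is \<Longrightarrow> regular_on W (a i)" "\<And>i. i \<in> set is \<Longrightarrow> regular_on W (b i)"
  shows "regular_on W (\<lambda>p. \<Sum>i\<leftarrow>is. a i p * b i p)"
  using assms(2,3)
proof (induction "is")
  case Nil
  show ?case using regular_const[OF assms(1), of 0] by simp
next
  case (Cons i "is")
  have "regular_on W (\<lambda>p. a i p * b i p)" using Cons.prems by (intro regular_mult) auto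
  then show ?case using regular_add[OF _ Cons.IH] Cons.prems by simp
qed

text \<open>With all functions on one open set no domains have to be intersected, and a list
  combination in the function field becomes a pointwise sum.\<close>

lemma combine_rat_class:
  fixes W :: "'k::alg_closed_field proj_line set"
  assumes "open W" "W \<noteq> {}" "\<And>i. i \<in> set is \<Longrightarrow> regular_on W (a i)" "\<And>i. i \<in> set is \<Longrightarrow> regular_on W (b i)"
  shows "ring.combine function_field (map (\<lambda>i. rat_class W (a i)) is) (map (\<lambda>i. rat_class W (b i)) is) =
    rat_class W (\<lambda>p. \<Sum>i\<leftarrow>is. a i p * b i p)"
proof -
  interpret field "function_field :: ('k proj_line set \<times> ('k proj_line \<Rightarrow> 'k)) set ring"
    by (rule field_function_field)
  show ?thesis
    using assms(3,4)
  proof (induction "is")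
    case Nil
    show ?case
      using rat_class_subset[OF rational_const assms(1,2)] by (simp add: function_field_zero)
  next
    case (Cons i "is")
    have r: "rational W (a i)" "rational W (b i)" "rational W (\<lambda>p. a i p * b i p)"
      "rational W (\<lambda>p. \<Sum>i\<leftarrow>is. a i p * b i p)"
      using Cons.prems assms(1,2) by (auto simp: rational_def intro!: regular_mult regular_lincomb)
    show ?case using Cons.IH Cons.prems by (simp add: rat_class_mult rat_class_add r)
  qed
qed

lemma nonvanishing_nonempty:
  fixes F :: "'k::alg_closed_field \<times> 'k \<Rightarrow> 'k"
  assumes "F \<in> forms d" "F v \<noteq> 0"
  shows "nonvanishing F \<noteq> {}"
proof -
  obtain t where "F (t, 1) \<noteq> 0" using MOST_imp_ex[OF form_nonzero_MOST[OF assms]] by blast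
  then have "point (t, 1) \<in> nonvanishing F" using point_in_nonvanishing[OF assms(1), of "(t, 1)"] by simp
  then show ?thesis by blast
qed

section \<open>The degree of the morphism\<close>

context line_map
begin

text \<open>By irreducibility the finitely many domains meet in a nonempty open set, so the
  coefficients of a linear relation become pullbacks from a single \<open>U\<close>.\<close>

lemma pullback_common_domain:
  fixes l :: nat
  assumes "\<And>i. i < l \<Longrightarrow> k i \<in> function_field_pullback f ` carrier function_field"
  obtains U s where "open U" "U \<noteq> {}" "\<And>i. i < l \<Longrightarrow> regular_on U (s i)"
    "\<And>i. i < l \<Longrightarrow> k i = rat_class (f -` U) (\<lambda>q. s i (f q))"
  using assms
proof (induction l arbitrary: thesis)
  case 0
  show ?case by (rule 0(1)[of UNIV]) auto
next
  case (Suc l)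
  obtain U s where U: "open U" "U \<noteq> {}" and s: "\<And>i. i < l \<Longrightarrow> regular_on U (s i)"
    "\<And>i. i < l \<Longrightarrow> k i = rat_class (f -` U) (\<lambda>q. s i (f q))"
    using Suc.IH Suc.prems(2) by (metis less_SucI)
  obtain V t where V: "rational V t" "k l = rat_class (f -` V) (\<lambda>q. t (f q))"
    using Suc.prems(2)[of l] function_field_pullback[OF morphism surj]
    by (auto elim!: function_field_cases)
  define W where "W = U \<inter> V"
  have W: "open W" "W \<noteq> {}" "W \<subseteq> U" "W \<subseteq> V"
    using U V(1) open_Int_nonempty[of U V] unfolding W_def rational_def by blast+
  show ?case
  proof (rule Suc.prems(1)[OF W(1,2), of "s(l := t)"])
    fix i assume i: "i < Suc l"
    have sub: "rat_class (f -` Z) (\<lambda>q. r (f q)) = rat_class (f -` W) (\<lambda>q. r (f q))" if "rational Z r" "W \<subseteq> Z" for Z r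
      using rational_vimage[OF morphism surj that(1)] open_vimage[OF W(1)] vimage_nonempty[OF W(2)] that(2)
      by (intro rat_class_subset) auto
    show "regular_on W ((s(l := t)) i)"
      using i s(1)[of i] V(1) W by (auto simp: rational_def less_Suc_eq intro: regular_on_subset)
    show "k i = rat_class (f -` W) (\<lambda>q. (s(l := t)) i (f q))"
      using i s V U sub[of V t] sub[of U "s i"] W by (auto simp: rational_def less_Suc_eq)
  qed
qed

text \<open>Independence is \<open>regular_independent\<close>. For spanning, the domain of a given
  rational function need not be a preimage under \<open>f\<close>; it is exchanged for the preimage
  of a set on which a pulled back denominator has no zeros, and there the decomposition
  applies.\<close>

lemma field_degree:
  "ring.dimension function_field d (function_field_pullback f ` carrier function_field) (carrier function_field)"
proof -
  interpret field "function_field :: ('a proj_line set \<times> ('a proj_line \<Rightarrow> 'a)) set ring"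
    by (rule field_function_field)
  let ?K = "function_field_pullback f ` carrier function_field"
  have K: "subfield ?K function_field" by (rule subfield_pullback[OF morphism surj])
  define N where "N = nonvanishing Q"
  define h where "h i = form_quotient (G i) Q" for i
  obtain u where u: "u \<noteq> (0, 0)" "Q u \<noteq> 0" by (rule Q_nonzero)
  have h_point: "h i (point v) = G i v / Q v" if "i < d" "v \<noteq> (0, 0)" for i v
    unfolding h_def by (rule form_quotient_point[OF G[OF that(1)] Q that(2)])
  have N: "open N" "N \<noteq> {}" unfolding N_def
    using open_nonvanishing[OF Q] point_in_nonvanishing[OF Q u(1)] u(2) by auto
  have pN: "point v \<in> N \<longleftrightarrow> Q v \<noteq> 0" if "v \<noteq> (0, 0)" for v
    unfolding N_def by (rule point_in_nonvanishing[OF Q that])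
  have h: "regular_on N (h i)" if "i < d" for i
    unfolding N_def h_def by (rule regular_form_quotient[OF G[OF that] Q])
  have rational_lincomb: "rational (f -` U \<inter> N) (\<lambda>q. \<Sum>i<d. s i (f q) * h i q)"
    if U: "open U" "U \<noteq> {}" "\<And>i. i < d \<Longrightarrow> regular_on U (s i)" for U s
  proof -
    have o: "open (f -` U \<inter> N)" "f -` U \<inter> N \<noteq> {}"
      using open_Int_nonempty[OF open_vimage[OF U(1)] vimage_nonempty[OF U(2)] N]
        open_vimage[OF U(1)] N by blast+
    have "regular_on (f -` U \<inter> N) (\<lambda>q. s i (f q))" "regular_on (f -` U \<inter> N) (h i)" if "i < d" for i
      by (rule regular_on_subset[OF regular_compose[OF morphism U(1) U(3)[OF that]] o(1)]
          regular_on_subset[OF h[OF that] o(1)], blast)+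
    then show ?thesis using o by (auto simp: rational_def intro!: regular_sum regular_mult simp del: disjoint_iff)
  qed
  define Us where "Us = map (\<lambda>i. rat_class N (h i)) [0..<d]"
  have Us: "set Us \<subseteq> carrier function_field"
    using h N by (auto simp: Us_def rational_def intro!: rat_class_in_carrier)
  have comb: "combine (map (\<lambda>i. rat_class (f -` U) (\<lambda>q. s i (f q))) [0..<d]) Us =
      rat_class (f -` U \<inter> N) (\<lambda>q. \<Sum>i<d. s i (f q) * h i q)"
    if U: "open U" "U \<noteq> {}" "\<And>i. i < d \<Longrightarrow> regular_on U (s i)" for U s
  proof -
    define W where "W = f -` U \<inter> N"
    have o: "open (f -` U)" "f -` U \<noteq> {}" using U open_vimage vimage_nonempty by auto
    have W: "open W" "W \<noteq> {}" "W \<subseteq> f -` U" "W \<subseteq> N"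
      using o N open_Int_nonempty unfolding W_def by blast+
    have r: "regular_on (f -` U) (\<lambda>q. s i (f q))" if "i < d" for i
      by (rule regular_compose[OF morphism U(1) U(3)[OF that]])
    have "map (\<lambda>i. rat_class (f -` U) (\<lambda>q. s i (f q))) [0..<d] = map (\<lambda>i. rat_class W (\<lambda>q. s i (f q))) [0..<d]"
    proof (rule map_cong[OF refl])
      fix i assume "i \<in> set [0..<d]"
      then have "rational (f -` U) (\<lambda>q. s i (f q))" using r o by (simp add: rational_def)
      then show "rat_class (f -` U) (\<lambda>q. s i (f q)) = rat_class W (\<lambda>q. s i (f q))"
        using W by (intro rat_class_subset) auto
    qed
    moreover have "Us = map (\<lambda>i. rat_class W (h i)) [0..<d]"
      unfolding Us_def
    proof (rule map_cong[OF refl])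
      fix i assume "i \<in> set [0..<d]"
      then have "rational N (h i)" using h N by (simp add: rational_def)
      then show "rat_class N (h i) = rat_class W (h i)"
        using W by (intro rat_class_subset) auto
    qed
    moreover have "combine (map (\<lambda>i. rat_class W (\<lambda>q. s i (f q))) [0..<d]) (map (\<lambda>i. rat_class W (h i)) [0..<d]) =
      rat_class W (\<lambda>p. \<Sum>i\<leftarrow>[0..<d]. s i (f p) * h i p)"
      by (rule combine_rat_class[OF W(1,2)])
        (auto intro: regular_on_subset[OF r W(1,3)] regular_on_subset[OF h W(1,4)])
    ultimately have "combine (map (\<lambda>i. rat_class (f -` U) (\<lambda>q. s i (f q))) [0..<d]) Us =
      rat_class W (\<lambda>p. \<Sum>i\<leftarrow>[0..<d]. s i (f p) * h i p)" by (simp only:)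
    then show ?thesis by (simp add: W_def sum_list_distinct_conv_sum_set atLeast0LessThan)
  qed
  have "independent ?K Us"
  proof (rule ccontr)
    assume "\<not> independent ?K Us"
    then obtain Ks where Ks: "length Ks = length Us" "combine Ks Us = \<zero>\<^bsub>function_field\<^esub>"
      "set Ks \<subseteq> ?K" "set Ks \<noteq> {\<zero>\<^bsub>function_field\<^esub>}"
      using dependent_imp_non_trivial_combine[OF K Us] by blast
    have l: "length Ks = d" using Ks(1) by (simp add: Us_def)
    obtain U s where U: "open U" "U \<noteq> {}" "\<And>i. i < d \<Longrightarrow> regular_on U (s i)"
      and k: "\<And>i. i < d \<Longrightarrow> Ks ! i = rat_class (f -` U) (\<lambda>q. s i (f q))"
    proof (rule pullback_common_domain[of d "(!) Ks"])
      show "Ks ! i \<in> ?K" if "i < d" for i using that Ks(3) l nth_mem by blast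
    qed blast
    have "Ks = map (\<lambda>i. rat_class (f -` U) (\<lambda>q. s i (f q))) [0..<d]"
      using k l by (intro nth_equalityI) auto
    then have "rat_class (f -` U \<inter> N) (\<lambda>q. \<Sum>i<d. s i (f q) * h i q) = \<zero>\<^bsub>function_field\<^esub>"
      using Ks(2) comb[OF U] by simp
    moreover have "rational (f -` U \<inter> N) (\<lambda>q. \<Sum>i<d. s i (f q) * h i q)"
      by (rule rational_lincomb[OF U])
    ultimately have *: "\<forall>q \<in> f -` U \<inter> N. (\<Sum>i<d. s i (f q) * h i q) = 0"
      using rat_class_eq_zero_iff by blast
    have sum0: "(\<Sum>i<d. s i (f (point v)) * (G i v / Q v)) = 0" if "v \<noteq> (0, 0)" "f (point v) \<in> U" "Q v \<noteq> 0" for v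
    proof -
      have "(\<Sum>i<d. s i (f (point v)) * (G i v / Q v)) = (\<Sum>i<d. s i (f (point v)) * h i (point v))"
        using h_point[OF _ that(1)] by simp
      then show ?thesis using * that pN[OF that(1)] by simp
    qed
    have s0: "s i p = 0" if "i < d" "p \<in> U" for i p
      by (rule regular_independent[OF U(1,3) sum0 that])
    have "Ks ! i = \<zero>\<^bsub>function_field\<^esub>" if "i < d" for i
    proof -
      have "rational (f -` U) (\<lambda>q. s i (f q))"
        using U that by (intro rational_vimage[OF morphism surj]) (simp add: rational_def)
      then show ?thesis
        unfolding k[OF that] using s0[OF that] by (simp add: rat_class_eq_zero_iff)
    qed
    then have "set Ks \<subseteq> {\<zero>\<^bsub>function_field\<^esub>}" using l by (metis in_set_conv_nth singletonI subsetI)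
    moreover have "Ks \<noteq> []" using l d by auto
    ultimately show False using Ks(4) by (cases Ks) auto
  qed
  moreover have "Span ?K Us = carrier function_field"
  proof
    show "Span ?K Us \<subseteq> carrier function_field"
      using Span_in_carrier[OF subfieldE(3)[OF K] Us] .
    show "carrier function_field \<subseteq> Span ?K Us"
    proof
      fix A :: "('a proj_line set \<times> ('a proj_line \<Rightarrow> 'a)) set"
      assume "A \<in> carrier function_field"
      then obtain V a where V: "rational V a" and A: "A = rat_class V a" by (rule function_field_cases)
      obtain e A0 B0 where "fraction_on V a e A0 B0"
        using regular_fraction V unfolding rational_def by metis
      note F = fraction_onD[OF this]
      have V': "open V" "V \<noteq> {}" using V by (auto simp: rational_def)
      then obtain p where "p \<in> V" by blast
      then have "B0 (rep p) \<noteq> 0" using F(3)[of "rep p"] rep[of p] by simp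
      then have nz: "\<exists>v. B0 v \<noteq> 0" by blast
      \<comment> \<open>No open set of the target is given yet, so the empty set is used and only
        the last clause of \<open>denominator_pullback\<close> shows that \<open>H\<close> is not
        the zero form.\<close>
      obtain H C where H: "H \<in> forms e" and HC: "\<And>v. H (P v, Q v) = B0 v * C v"
          "(\<exists>v. B0 v \<noteq> 0) \<Longrightarrow> (\<exists>w. H w \<noteq> 0)"
        by (rule denominator_pullback[OF F(2), of "{}"]) (simp, rule that)
      \<comment> \<open>On the preimage of this set neither \<open>H (P, Q)\<close>, and with it
        \<open>B0\<close>, nor \<open>Q\<close> has a zero.\<close>
      define U where "U = nonvanishing H \<inter> nonvanishing snd"
      have "nonvanishing H \<noteq> {}" using HC(2)[OF nz] nonvanishing_nonempty[OF H] by blast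
      moreover have "nonvanishing snd \<noteq> ({} :: 'a proj_line set)"
        using nonvanishing_nonempty[OF form_snd, of "(0, 1)"] by simp
      ultimately have U: "open U" "U \<noteq> {}"
        using open_nonvanishing[OF H] open_nonvanishing[OF form_snd] open_Int_nonempty
        unfolding U_def by blast+
      have pU: "H w \<noteq> 0 \<and> snd w \<noteq> 0" if "w \<noteq> (0, 0)" "point w \<in> U" for w
        using that point_in_nonvanishing[OF H that(1)] point_in_nonvanishing[OF form_snd that(1)]
        by (auto simp: U_def)
      have fU: "B0 v \<noteq> 0 \<and> Q v \<noteq> 0" if "v \<noteq> (0, 0)" "f (point v) \<in> U" for v
        using pU[OF PQ_nonzero[OF that(1)]] that f_point HC(1)[of v] by auto
      define g where "g = form_quotient A0 B0"
      have g: "regular_on (f -` U) g" unfolding g_def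
        using fU by (intro regular_onI[OF open_vimage[OF U(1)] fraction_on_form_quotient[OF F(1,2)]]) auto
      have gr: "rational (f -` U) g" using g open_vimage vimage_nonempty U by (simp add: rational_def)
      have "MOST x. a (point (x, 1)) = g (point (x, 1))"
        using open_MOST[OF V']
      proof eventually_elim
        case (elim x)
        then show ?case unfolding g_def
          using F(4)[of "(x, 1)"] form_quotient_point[OF F(1,2), of "(x, 1)"] by simp
      qed
      then have Ag: "A = rat_class (f -` U) g"
        unfolding A using rat_class_eq_iff[OF V gr] by simp
      obtain m H' R S where H': "H' \<in> forms m" "\<And>w. w \<noteq> (0, 0) \<Longrightarrow> point w \<in> U \<Longrightarrow> H' w \<noteq> 0"
        and R: "R \<in> forms m" and S: "\<And>i. S i \<in> lower_forms m"
        and gv: "\<And>v. v \<noteq> (0, 0) \<Longrightarrow> f (point v) \<in> U \<Longrightarrow>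
          g (point v) = (R (P v, Q v) + (\<Sum>i<d - 1. S i (P v, Q v) * G (Suc i) v)) / H' (P v, Q v)"
        by (rule regular_vimage_decompose[OF U g]) (rule that)
      \<comment> \<open>\<open>S i\<close> has degree one less than \<open>R\<close>. The extra
        factor \<open>snd\<close> restores degree \<open>m\<close>; at \<open>(P, Q)\<close> it
        becomes \<open>Q\<close> and cancels the denominator of
        \<open>G (Suc i) / Q\<close>.\<close>
      define T where "T i = (if i = 0 then R else (\<lambda>w. S (i - 1) w * snd w))" for i
      define s where "s i = form_quotient (T i) H'" for i
      have T: "T i \<in> forms m" for i using R lower_forms_mult[OF S form_snd] by (simp add: T_def)
      have s: "regular_on U (s i)" for i unfolding s_def
        by (rule regular_onI[OF U(1) fraction_on_form_quotient[OF T H'(1,2)]])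
      have sum: "(\<Sum>i<d. s i (f q) * h i q) = g q" if q: "q \<in> f -` U" for q
      proof -
        obtain v where v: "v \<noteq> (0, 0)" "q = point v" by (rule point_cases)
        have fv: "f (point v) \<in> U" "Q v \<noteq> 0" using q v fU by auto
        have "s i (f q) = T i (P v, Q v) / H' (P v, Q v)" for i
          unfolding s_def v(2) f_point[OF v(1)] by (rule form_quotient_point[OF T H'(1) PQ_nonzero[OF v(1)]])
        then have "(\<Sum>i<d. s i (f q) * h i q) = (\<Sum>i<Suc (d - 1). T i (P v, Q v) / H' (P v, Q v) * (G i v / Q v))"
          using d h_point[OF _ v(1)] by (intro sum.cong) (simp_all add: v(2))
        also have "\<dots> = R (P v, Q v) / H' (P v, Q v) + (\<Sum>i<d - 1. S i (P v, Q v) * G (Suc i) v / H' (P v, Q v))"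
          using fv(2) by (subst sum.lessThan_Suc_shift) (simp add: T_def G0)
        also have "\<dots> = g q"
          unfolding v(2) gv[OF v(1) fv(1)] by (simp add: add_divide_distrib sum_divide_distrib)
        finally show ?thesis .
      qed
      define Ks where "Ks = map (\<lambda>i. rat_class (f -` U) (\<lambda>q. s i (f q))) [0..<d]"
      have "rat_class (f -` U \<inter> N) (\<lambda>q. \<Sum>i<d. s i (f q) * h i q) = rat_class (f -` U) g"
      proof -
        have o: "open (f -` U \<inter> N)" "f -` U \<inter> N \<noteq> {}"
          using open_Int_nonempty[OF open_vimage[OF U(1)] vimage_nonempty[OF U(2)] N]
            open_vimage[OF U(1)] N by blast+
        have "rat_class (f -` U) g = rat_class (f -` U \<inter> N) g"
          by (rule rat_class_subset[OF gr o]) blast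
        then show ?thesis using sum by (auto simp: rat_class_def)
      qed
      then have "combine Ks Us = A" unfolding Ks_def Ag using comb[OF U s] by simp
      moreover have "set Ks \<subseteq> ?K"
      proof -
        have "rat_class (f -` U) (\<lambda>q. s i (f q)) \<in> ?K" for i
          using function_field_pullback[OF morphism surj, of U "s i"] s U rat_class_in_carrier[of U "s i"]
          by (metis image_eqI rational_def)
        then show ?thesis by (auto simp: Ks_def)
      qed
      moreover have "length Ks = length Us" by (simp add: Ks_def Us_def)
      ultimately show "A \<in> Span ?K Us" unfolding Span_mem_iff_length_version[OF K Us] by blast
    qed
  qed
  ultimately have "dimension (length Us) ?K (carrier function_field)" by (rule dimensionI[OF K])
  then show ?thesis by (simp add: Us_def)
qed

end

section \<open>The isomorphism\<close>

text \<open>The explicit map goes from the sum to the direct image, against the direction in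
  \<open>module_sheaf_iso\<close>. Sheaves of modules are bare data, so closure of \<open>N\<close>
  under its operations has to be supplied: the inverse undoes \<open>\<psi> U\<close> only on the
  carrier.\<close>

lemma module_sheaf_isoI_inverse:
  fixes M :: "('k::field, 'm) module_sheaf" and N :: "('k, 'n) module_sheaf"
  assumes bij: "\<And>U. open U \<Longrightarrow> bij_betw (\<psi> U) (carrier (sections N U)) (carrier (sections M U))"
    and add_closed: "\<And>U x y. open U \<Longrightarrow> x \<in> carrier (sections N U) \<Longrightarrow> y \<in> carrier (sections N U) \<Longrightarrow>
      x \<oplus>\<^bsub>sections N U\<^esub> y \<in> carrier (sections N U)"
    and smult_closed: "\<And>U a x. open U \<Longrightarrow> a \<in> carrier (regular_functions U) \<Longrightarrow> x \<in> carrier (sections N U) \<Longrightarrow>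
      a \<odot>\<^bsub>sections N U\<^esub> x \<in> carrier (sections N U)"
    and restr_closed: "\<And>U V x. open U \<Longrightarrow> open V \<Longrightarrow> V \<subseteq> U \<Longrightarrow> x \<in> carrier (sections N U) \<Longrightarrow>
      restr N U V x \<in> carrier (sections N V)"
    and add: "\<And>U x y. open U \<Longrightarrow> x \<in> carrier (sections N U) \<Longrightarrow> y \<in> carrier (sections N U) \<Longrightarrow>
      \<psi> U (x \<oplus>\<^bsub>sections N U\<^esub> y) = \<psi> U x \<oplus>\<^bsub>sections M U\<^esub> \<psi> U y"
    and smult: "\<And>U a x. open U \<Longrightarrow> a \<in> carrier (regular_functions U) \<Longrightarrow> x \<in> carrier (sections N U) \<Longrightarrow>
      \<psi> U (a \<odot>\<^bsub>sections N U\<^esub> x) = a \<odot>\<^bsub>sections M U\<^esub> \<psi> U x"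
    and restr: "\<And>U V x. open U \<Longrightarrow> open V \<Longrightarrow> V \<subseteq> U \<Longrightarrow> x \<in> carrier (sections N U) \<Longrightarrow>
      \<psi> V (restr N U V x) = restr M U V (\<psi> U x)"
  shows "M \<cong>\<^sub>O N"
proof -
  define \<phi> where "\<phi> U = inv_into (carrier (sections N U)) (\<psi> U)" for U
  have l: "\<phi> U (\<psi> U x) = x" if "open U" "x \<in> carrier (sections N U)" for U x
    using bij[OF that(1)] that(2) by (simp add: \<phi>_def bij_betw_def inv_into_f_f)
  have ex: "\<exists>x'. x' \<in> carrier (sections N U) \<and> x = \<psi> U x'" if "open U" "x \<in> carrier (sections M U)" for U x
    using bij[OF that(1)] that(2) by (auto simp: bij_betw_def)
  show ?thesis
    unfolding module_sheaf_iso_def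
  proof (intro exI[of _ \<phi>] conjI allI impI ballI)
    fix U :: "'k proj_line set" assume U: "open U"
    show "bij_betw (\<phi> U) (carrier (sections M U)) (carrier (sections N U))"
      unfolding \<phi>_def by (rule bij_betw_inv_into[OF bij[OF U]])
    fix x assume "x \<in> carrier (sections M U)"
    then obtain x' where x: "x' \<in> carrier (sections N U)" "x = \<psi> U x'" using ex U by blast
    show "\<phi> U (a \<odot>\<^bsub>sections M U\<^esub> x) = a \<odot>\<^bsub>sections N U\<^esub> \<phi> U x"
      if a: "a \<in> carrier (regular_functions U)" for a
      unfolding x(2) smult[OF U a x(1), symmetric] l[OF U smult_closed[OF U a x(1)]] l[OF U x(1)] ..
    show "\<phi> V (restr M U V x) = restr N U V (\<phi> U x)" if V: "open V" "V \<subseteq> U" for V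
      unfolding x(2) restr[OF U V x(1), symmetric] l[OF V(1) restr_closed[OF U V x(1)]] l[OF U x(1)] ..
    fix y assume "y \<in> carrier (sections M U)"
    then obtain y' where y: "y' \<in> carrier (sections N U)" "y = \<psi> U y'" using ex U by blast
    show "\<phi> U (x \<oplus>\<^bsub>sections M U\<^esub> y) = \<phi> U x \<oplus>\<^bsub>sections N U\<^esub> \<phi> U y"
      unfolding x(2) y(2) add[OF U x(1) y(1), symmetric] l[OF U add_closed[OF U x(1) y(1)]] l[OF U x(1)] l[OF U y(1)] ..
  qed
qed

section \<open>Sections of the tautological bundle and the operations on both sides\<close>

lemma carrier_regular_functions: "carrier (regular_functions U) = {s \<in> extensional U. regular_on U s}"
  by (simp add: regular_functions_def)

lemma in_line_of_point: "v \<noteq> (0, 0) \<Longrightarrow> u \<in> line_of (point v) \<longleftrightarrow> (\<exists>c. u = scaled c v)"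
  by (simp add: line_of_point line_through_iff)

text \<open>The scalar \<open>c\<close> with \<open>u = scaled c w\<close>; a junk value if \<open>u\<close> is not a multiple of \<open>w\<close>.\<close>

definition ratio :: "'k::field \<times> 'k \<Rightarrow> 'k \<times> 'k \<Rightarrow> 'k" where
  "ratio u w = (if snd w \<noteq> 0 then snd u / snd w else fst u / fst w)"

lemma ratio_scaled: "w \<noteq> (0, 0) \<Longrightarrow> ratio (scaled c w) w = c"
  by (cases w) (auto simp: ratio_def scaled_def)

lemma ratio_add: "ratio (fst u + fst v, snd u + snd v) w = ratio u w + ratio v w"
  by (simp add: ratio_def add_divide_distrib)

lemma ratio_mult: "ratio (a * fst u, a * snd u) w = a * ratio u w"
  by (simp add: ratio_def)

definition taut_sections :: "'k::field proj_line set \<Rightarrow> ('k proj_line \<Rightarrow> 'k \<times> 'k) set" where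
  "taut_sections U = {\<sigma> \<in> extensional U. regular_on U (\<lambda>p. fst (\<sigma> p)) \<and>
             regular_on U (\<lambda>p. snd (\<sigma> p)) \<and> (\<forall>p \<in> U. \<sigma> p \<in> line_of p)}"

lemma line_of_add: "u \<in> line_of p \<Longrightarrow> v \<in> line_of p \<Longrightarrow> (fst u + fst v, snd u + snd v) \<in> line_of p"
  by (cases p rule: point_cases)
    (auto simp: in_line_of_point scaled_def distrib_right intro: exI[of _ "_ + _"])

lemma line_of_mult: "u \<in> line_of p \<Longrightarrow> (a * fst u, a * snd u) \<in> line_of p"
  by (cases p rule: point_cases) (auto simp: in_line_of_point scaled_def mult.assoc intro: exI[of _ "_ * _"])

lemma taut_sections_add:
  assumes "\<sigma> \<in> taut_sections U" "\<tau> \<in> taut_sections U"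
  shows "(\<lambda>p\<in>U. (fst (\<sigma> p) + fst (\<tau> p), snd (\<sigma> p) + snd (\<tau> p))) \<in> taut_sections U"
  using assms unfolding taut_sections_def
  by (auto intro: line_of_add regular_on_cong[OF regular_add])

lemma taut_sections_mult:
  assumes "regular_on U a" "\<sigma> \<in> taut_sections U"
  shows "(\<lambda>p\<in>U. (a p * fst (\<sigma> p), a p * snd (\<sigma> p))) \<in> taut_sections U"
  using assms unfolding taut_sections_def
  by (auto intro: line_of_mult regular_on_cong[OF regular_mult])

lemma taut_sections_restrict:
  assumes "\<sigma> \<in> taut_sections U" "open V" "V \<subseteq> U"
  shows "restrict \<sigma> V \<in> taut_sections V"
  using assms unfolding taut_sections_def
  by (auto intro: regular_on_cong[OF regular_on_subset])

lemma carrier_sum_power: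
  "carrier (sections (\<O> \<oplus>\<^sub>O \<O>(-1) ^\<^sub>O r) U) =
    carrier (regular_functions U) \<times> ({..<r} \<rightarrow>\<^sub>E taut_sections U)"
  by (simp add: direct_sum_def direct_power_def trivial_line_bundle_def tautological_line_bundle_def taut_sections_def)

lemma add_sum_power:
  "x \<oplus>\<^bsub>sections (\<O> \<oplus>\<^sub>O \<O>(-1) ^\<^sub>O r) U\<^esub> y = (\<lambda>p\<in>U. fst x p + fst y p,
    \<lambda>i\<in>{..<r}. \<lambda>p\<in>U. (fst (snd x i p) + fst (snd y i p), snd (snd x i p) + snd (snd y i p)))"
  by (simp add: direct_sum_def direct_power_def trivial_line_bundle_def tautological_line_bundle_def
      regular_functions_def case_prod_unfold)

lemma smult_sum_power:
  "a \<odot>\<^bsub>sections (\<O> \<oplus>\<^sub>O \<O>(-1) ^\<^sub>O r) U\<^esub> x = (\<lambda>p\<in>U. a p * fst x p,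
    \<lambda>i\<in>{..<r}. \<lambda>p\<in>U. (a p * fst (snd x i p), a p * snd (snd x i p)))"
  by (simp add: direct_sum_def direct_power_def trivial_line_bundle_def tautological_line_bundle_def
      regular_functions_def case_prod_unfold)

lemma restr_sum_power:
  "restr (\<O> \<oplus>\<^sub>O \<O>(-1) ^\<^sub>O r) U V x = (restrict (fst x) V, \<lambda>i\<in>{..<r}. restrict (snd x i) V)"
  by (simp add: direct_sum_def direct_power_def trivial_line_bundle_def tautological_line_bundle_def
      case_prod_unfold)

lemma carrier_direct_image: "carrier (sections (direct_image f \<O>) U) = carrier (regular_functions (f -` U))"
  by (simp add: direct_image_def trivial_line_bundle_def)

lemma add_direct_image: "g \<oplus>\<^bsub>sections (direct_image f \<O>) U\<^esub> h = (\<lambda>p\<in>f -` U. g p + h p)"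
  by (simp add: direct_image_def trivial_line_bundle_def regular_functions_def)

lemma smult_direct_image:
  "a \<odot>\<^bsub>sections (direct_image f \<O>) U\<^esub> h = (\<lambda>p\<in>f -` U. a (f p) * h p)"
  by (auto simp: direct_image_def trivial_line_bundle_def regular_functions_def pullback_def)

lemma restr_direct_image: "restr (direct_image f \<O>) U V h = restrict h (f -` V)"
  by (simp add: direct_image_def trivial_line_bundle_def)

section \<open>The map from the sum to the direct image and its bijectivity\<close>

context line_map
begin

definition from_sum ::
    "'a proj_line set \<Rightarrow> ('a proj_line \<Rightarrow> 'a) \<times> (nat \<Rightarrow> 'a proj_line \<Rightarrow> 'a \<times> 'a) \<Rightarrow> 'a proj_line \<Rightarrow> 'a" where
  "from_sum U x = (\<lambda>q\<in>f -` U. fst x (f q) +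
    (\<Sum>i<d - 1. ratio (snd x i (f q)) (P (rep q), Q (rep q)) * G (Suc i) (rep q)))"

text \<open>Scaling the representative by \<open>c\<close> multiplies \<open>P\<close>,
  \<open>Q\<close> and every \<open>G (Suc i)\<close> by \<open>c ^ d\<close>, so
  \<open>ratio\<close> loses exactly the factor that \<open>G (Suc i)\<close> gains. The value
  therefore does not depend on the vector chosen by \<open>rep\<close>.\<close>

lemma from_sum_point:
  assumes v: "v \<noteq> (0, 0)" "f (point v) \<in> U"
  shows "from_sum U x (point v) = fst x (f (point v)) +
    (\<Sum>i<d - 1. ratio (snd x i (f (point v))) (P v, Q v) * G (Suc i) v)"
proof -
  obtain c where c: "c \<noteq> 0" "rep (point v) = scaled c v" using rep_point[OF v(1)] by blast
  have "ratio u (P (scaled c v), Q (scaled c v)) * G (Suc i) (scaled c v) = ratio u (P v, Q v) * G (Suc i) v"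
    if "i < d - 1" for u i
    using c(1) form_scaled[OF P, of c v] form_scaled[OF Q, of c v] form_scaled[OF G, of "Suc i" c v] that
    by (simp add: ratio_def)
  then show ?thesis using v by (simp add: from_sum_def c(2))
qed

lemma ratio_snd: "Q v \<noteq> 0 \<Longrightarrow> ratio u (P v, Q v) = snd u / Q v"
  by (simp add: ratio_def)

text \<open>\<open>ratio\<close> prefers the second coordinate; in general the first one yields the
  same scalar only for vectors on the line of \<open>(P v, Q v)\<close>.\<close>

lemma ratio_fst:
  assumes "P v \<noteq> 0" "v \<noteq> (0, 0)" "u \<in> line_of (f (point v))"
  shows "ratio u (P v, Q v) = fst u / P v"
proof -
  have w: "(P v, Q v) \<noteq> (0, 0)" using assms(1) by simp
  obtain c where "u = scaled c (P v, Q v)"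
    using assms(3) in_line_of_point[OF w] by (auto simp: f_point[OF assms(2)])
  then show ?thesis using ratio_scaled[OF w, of c] assms(1) by (simp add: scaled_def)
qed

text \<open>\<open>P\<close> and \<open>Q\<close> never vanish together, so near each point the
  scalar is the second coordinate of the section over \<open>Q\<close> or the first over
  \<open>P\<close>. The local claim \<open>part\<close> treats both cases, with \<open>L\<close> as
  denominator and \<open>\<pi>\<close> as coordinate.\<close>

lemma from_sum_regular:
  assumes U: "open U" and s: "regular_on U s" and \<sigma>: "\<And>i. i < d - 1 \<Longrightarrow> \<sigma> i \<in> taut_sections U"
  shows "regular_on (f -` U) (from_sum U (s, \<sigma>))"
proof (rule regular_on_local)
  fix q assume q: "q \<in> f -` U"
  obtain v where v: "v \<noteq> (0, 0)" "q = point v" by (rule point_cases)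
  have GS: "G (Suc i) \<in> forms d" if "i < d - 1" for i using that by (intro G) simp
  have part: "\<exists>W. open W \<and> q \<in> W \<and> W \<subseteq> f -` U \<and> regular_on W (from_sum U (s, \<sigma>))"
    if L: "L \<in> forms d" "L v \<noteq> 0" and r: "\<And>i. i < d - 1 \<Longrightarrow> regular_on U (\<lambda>p. \<pi> (\<sigma> i p))"
      and eq: "\<And>i w. i < d - 1 \<Longrightarrow> w \<noteq> (0, 0) \<Longrightarrow> f (point w) \<in> U \<Longrightarrow> L w \<noteq> 0 \<Longrightarrow>
        ratio (\<sigma> i (f (point w))) (P w, Q w) = \<pi> (\<sigma> i (f (point w))) / L w" for L \<pi>
  proof -
    define W where "W = f -` U \<inter> nonvanishing L"
    have W: "open W" "q \<in> W" "W \<subseteq> f -` U" "W \<subseteq> nonvanishing L"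
      using open_vimage[OF U] open_nonvanishing[OF L(1)] point_in_nonvanishing[OF L(1) v(1)] q v(2) L(2)
      by (auto simp: W_def)
    have "regular_on W (\<lambda>q. \<pi> (\<sigma> i (f q)) * form_quotient (G (Suc i)) L q)" if "i < d - 1" for i
      by (rule regular_mult[OF regular_on_subset[OF regular_compose[OF morphism U r[OF that]] W(1,3)]
          regular_on_subset[OF regular_form_quotient[OF GS[OF that] L(1)] W(1,4)]])
    then have "regular_on W (\<lambda>q. s (f q) + (\<Sum>i<d - 1. \<pi> (\<sigma> i (f q)) * form_quotient (G (Suc i)) L q))"
      by (intro regular_add regular_sum W(1) regular_on_subset[OF regular_compose[OF morphism U s] W(1,3)]) auto
    then have "regular_on W (from_sum U (s, \<sigma>))"
    proof (rule regular_on_cong)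
      fix p assume p: "p \<in> W"
      obtain w where w: "w \<noteq> (0, 0)" "p = point w" by (rule point_cases)
      have fw: "f (point w) \<in> U" "L w \<noteq> 0"
        using p w point_in_nonvanishing[OF L(1) w(1)] by (auto simp: W_def)
      show "from_sum U (s, \<sigma>) p = s (f p) + (\<Sum>i<d - 1. \<pi> (\<sigma> i (f p)) * form_quotient (G (Suc i)) L p)"
        unfolding w(2) from_sum_point[OF w(1) fw(1)]
        using eq[OF _ w(1) fw] form_quotient_point[OF GS L(1) w(1)] by simp
    qed
    with W show ?thesis by blast
  qed
  show "\<exists>W. open W \<and> q \<in> W \<and> W \<subseteq> f -` U \<and> regular_on W (from_sum U (s, \<sigma>))"
  proof (cases "Q v = 0")
    case False
    show ?thesis
      by (rule part[OF Q False, of snd]) (use \<sigma> in \<open>auto simp: taut_sections_def ratio_snd\<close>)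
  next
    case True
    then have "P v \<noteq> 0" using PQ_nonzero[OF v(1)] by simp
    then show ?thesis
      by (rule part[OF P, of fst]) (use \<sigma> in \<open>auto simp: taut_sections_def intro!: ratio_fst\<close>)
  qed
qed

text \<open>Where \<open>Q\<close> is nonzero, equality of the images is a relation between the
  quotients \<open>G i / Q\<close> whose coefficients, for positive \<open>i\<close>, are
  differences of second coordinates. These determine a vector on its line except over the point
  \<open>(1, 0)\<close>; the identity theorem for the first coordinates closes this gap.\<close>

lemma from_sum_inj:
  assumes U: "open U" and s: "regular_on U s" "regular_on U t"
    and \<sigma>: "\<And>i. i < d - 1 \<Longrightarrow> \<sigma> i \<in> taut_sections U" and \<tau>: "\<And>i. i < d - 1 \<Longrightarrow> \<tau> i \<in> taut_sections U"
    and eq: "from_sum U (s, \<sigma>) = from_sum U (t, \<tau>)" and p: "p \<in> U"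
  shows "s p = t p" "i < d - 1 \<Longrightarrow> \<sigma> i p = \<tau> i p"
proof -
  define r where "r i = (\<lambda>p. if i = 0 then s p + -1 * t p else snd (\<sigma> (i - 1) p) + -1 * snd (\<tau> (i - 1) p))" for i
  have r: "regular_on U (r i)" if "i < d" for i
  proof (cases i)
    case 0
    then show ?thesis
      using regular_add[OF s(1) regular_mult[OF regular_const[OF U] s(2)], of "-1"] by (simp add: r_def)
  next
    case (Suc j)
    then have "regular_on U (\<lambda>p. snd (\<sigma> j p))" "regular_on U (\<lambda>p. snd (\<tau> j p))"
      using \<sigma>[of j] \<tau>[of j] that by (auto simp: taut_sections_def)
    then show ?thesis
      using regular_add[OF _ regular_mult[OF regular_const[OF U]], of "\<lambda>p. snd (\<sigma> j p)" "\<lambda>p. snd (\<tau> j p)" "-1"] Suc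
      by (simp add: r_def)
  qed
  have r0: "r i p = 0" if "i < d" "p \<in> U" for i p
  proof (rule regular_independent[OF U r _ that])
    fix v assume v: "v \<noteq> (0, 0)" "f (point v) \<in> U" "Q v \<noteq> 0"
    define y where "y = f (point v)"
    have "s y + (\<Sum>i<d - 1. snd (\<sigma> i y) / Q v * G (Suc i) v) = t y + (\<Sum>i<d - 1. snd (\<tau> i y) / Q v * G (Suc i) v)"
      using fun_cong[OF eq, of "point v"] unfolding from_sum_point[OF v(1,2)]
      by (simp add: ratio_snd[OF v(3)] y_def)
    moreover have "(\<Sum>i<d. r i y * (G i v / Q v)) = (\<Sum>i<Suc (d - 1). r i y * (G i v / Q v))"
      using d by simp
    moreover have "\<dots> = s y - t y + (\<Sum>i<d - 1. (snd (\<sigma> i y) - snd (\<tau> i y)) * (G (Suc i) v / Q v))"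
      by (subst sum.lessThan_Suc_shift) (simp add: r_def G0 v(3))
    moreover have "\<dots> = s y + (\<Sum>i<d - 1. snd (\<sigma> i y) / Q v * G (Suc i) v) -
        (t y + (\<Sum>i<d - 1. snd (\<tau> i y) / Q v * G (Suc i) v))"
      by (simp add: algebra_simps sum_subtractf)
    ultimately show "(\<Sum>i<d. r i (f (point v)) * (G i v / Q v)) = 0" by (simp add: y_def)
  qed
  show "s p = t p" using r0[of 0 p] d p by (simp add: r_def)
  assume i: "i < d - 1"
  have snd_eq: "snd (\<sigma> i p) = snd (\<tau> i p)" if "p \<in> U" for p
    using r0[of "Suc i" p] i that by (simp add: r_def)
  have "fst (\<sigma> i p) = fst (\<tau> i p)"
  proof (rule regular_eqI_MOST[OF U _ _ _ p])
    show "regular_on U (\<lambda>p. fst (\<sigma> i p))" "regular_on U (\<lambda>p. fst (\<tau> i p))"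
      using \<sigma>[OF i] \<tau>[OF i] by (auto simp: taut_sections_def)
    have "U \<noteq> {}" using p by blast
    from open_MOST[OF U this] show "MOST x. fst (\<sigma> i (point (x, 1))) = fst (\<tau> i (point (x, 1)))"
    proof (rule eventually_mono)
      fix x :: 'a assume x: "point (x, 1) \<in> U"
      then have "\<sigma> i (point (x, 1)) \<in> line_of (point (x, 1))" "\<tau> i (point (x, 1)) \<in> line_of (point (x, 1))"
        using \<sigma>[OF i] \<tau>[OF i] by (auto simp: taut_sections_def)
      then obtain a b where "\<sigma> i (point (x, 1)) = scaled a (x, 1)" "\<tau> i (point (x, 1)) = scaled b (x, 1)"
        using in_line_of_point[of "(x, 1)"] by auto
      then show "fst (\<sigma> i (point (x, 1))) = fst (\<tau> i (point (x, 1)))"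
        using snd_eq[OF x] by (simp add: scaled_def)
    qed
  qed
  then show "\<sigma> i p = \<tau> i p" using snd_eq[OF p] by (simp add: prod_eq_iff)
qed

text \<open>The decomposition of \<open>h\<close> supplies the function \<open>R / H\<close> and the
  quotients \<open>S i / H\<close> of degree -1. Multiplying the latter by both coordinates of
  \<open>w\<close> gives quotients of forms of equal degree, the components of a tautological
  section.\<close>

lemma from_sum_surj:
  assumes U: "open U" and h: "h \<in> extensional (f -` U)" "regular_on (f -` U) h"
  obtains x where "x \<in> carrier (regular_functions U) \<times> ({..<d - 1} \<rightarrow>\<^sub>E taut_sections U)" "from_sum U x = h"
proof -
  obtain m H R S where H: "H \<in> forms m" "\<And>w. w \<noteq> (0, 0) \<Longrightarrow> point w \<in> U \<Longrightarrow> H w \<noteq> 0"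
    and R: "R \<in> forms m" and S: "\<And>i. S i \<in> lower_forms m"
    and hv: "\<And>v. v \<noteq> (0, 0) \<Longrightarrow> f (point v) \<in> U \<Longrightarrow>
      h (point v) = (R (P v, Q v) + (\<Sum>i<d - 1. S i (P v, Q v) * G (Suc i) v)) / H (P v, Q v)"
  proof (cases "U = {}")
    case True
    \<comment> \<open>Over the empty set any data will do; \<open>regular_vimage_decompose\<close>
      is stated for nonempty \<open>U\<close>.\<close>
    show ?thesis by (rule that[of "\<lambda>_. 1" 0 "\<lambda>_. 0" "\<lambda>_ _. 0"]) (auto simp: True form_const lower_forms_def)
  next
    case False
    show ?thesis by (rule regular_vimage_decompose[OF U False h(2)]) (rule that)
  qed
  define s where "s = restrict (form_quotient R H) U"
  define S1 where "S1 i = form_quotient (\<lambda>w. S i w * fst w) H" for i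
  define S2 where "S2 i = form_quotient (\<lambda>w. S i w * snd w) H" for i
  define \<sigma> where "\<sigma> = (\<lambda>i\<in>{..<d - 1}. \<lambda>p\<in>U. (S1 i p, S2 i p))"
  have reg: "regular_on U (form_quotient F H)" if "F \<in> forms m" for F
    by (rule regular_onI[OF U fraction_on_form_quotient[OF that H]])
  have F: "(\<lambda>w. S i w * fst w) \<in> forms m" "(\<lambda>w. S i w * snd w) \<in> forms m" for i
    by (rule lower_forms_mult[OF S] form_fst form_snd)+
  have "(S1 i p, S2 i p) = scaled (S i (rep p) / H (rep p)) (rep p)" for i p
    by (simp add: S1_def S2_def form_quotient_def scaled_def)
  then have "(S1 i p, S2 i p) \<in> line_of p" for i p
    using in_line_of_point[OF rep(1)[of p]] rep(2)[of p] by auto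
  then have "\<sigma> i \<in> taut_sections U" if "i < d - 1" for i
    using that reg[OF F(1), of i] reg[OF F(2), of i]
    by (auto simp: \<sigma>_def taut_sections_def S1_def S2_def intro: regular_on_cong)
  then have "(s, \<sigma>) \<in> carrier (regular_functions U) \<times> ({..<d - 1} \<rightarrow>\<^sub>E taut_sections U)"
    using regular_on_cong[OF reg[OF R]] by (auto simp: s_def carrier_regular_functions \<sigma>_def)
  moreover have "from_sum U (s, \<sigma>) = h"
  proof (rule extensionalityI[OF _ h(1)])
    show "from_sum U (s, \<sigma>) \<in> extensional (f -` U)" by (simp add: from_sum_def)
    fix q assume q: "q \<in> f -` U"
    obtain v where v: "v \<noteq> (0, 0)" "q = point v" by (rule point_cases)
    define w where "w = (P v, Q v)"
    have w: "w \<noteq> (0, 0)" "f (point v) = point w" "f (point v) \<in> U"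
      using PQ_nonzero[OF v(1)] f_point[OF v(1)] q v by (auto simp: w_def)
    have "\<sigma> i (f (point v)) = scaled (S i w / H w) w" if "i < d - 1" for i
      using that w form_quotient_point[OF F(1) H(1) w(1)] form_quotient_point[OF F(2) H(1) w(1)]
      by (simp add: \<sigma>_def S1_def S2_def scaled_def)
    then have "from_sum U (s, \<sigma>) (point v) = R w / H w + (\<Sum>i<d - 1. S i w / H w * G (Suc i) v)"
      unfolding from_sum_point[OF v(1) w(3)] w_def[symmetric]
      using w form_quotient_point[OF R H(1) w(1)] by (simp add: s_def ratio_scaled)
    also have "\<dots> = h (point v)"
      unfolding hv[OF v(1) w(3)] w_def[symmetric] by (simp add: add_divide_distrib sum_divide_distrib)
    finally show "from_sum U (s, \<sigma>) q = h q" by (simp add: v(2))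
  qed
  ultimately show ?thesis by (rule that)
qed

text \<open>Beyond bijectivity the checks are pointwise: \<open>ratio\<close> is additive and
  homogeneous in its first argument, and a scalar \<open>a\<close> enters \<open>from_sum\<close> at
  \<open>f q\<close>, which is how it acts on the direct image.\<close>

lemma direct_image_iso: "direct_image f \<O> \<cong>\<^sub>O \<O> \<oplus>\<^sub>O \<O>(-1) ^\<^sub>O (d - 1)"
proof (rule module_sheaf_isoI_inverse[where \<psi> = from_sum],
    unfold carrier_sum_power add_sum_power smult_sum_power restr_sum_power carrier_direct_image
      add_direct_image smult_direct_image restr_direct_image)
  fix U :: "'a proj_line set" assume U: "open U"
  let ?C = "carrier (regular_functions U) \<times> ({..<d - 1} \<rightarrow>\<^sub>E taut_sections U)"
  show "bij_betw (from_sum U) ?C (carrier (regular_functions (f -` U)))"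
    unfolding bij_betw_def
  proof
    show "inj_on (from_sum U) ?C"
    proof (rule inj_onI)
      fix x y assume "x \<in> ?C" "y \<in> ?C" and eq: "from_sum U x = from_sum U y"
      moreover obtain s \<sigma> t \<tau> where xy: "x = (s, \<sigma>)" "y = (t, \<tau>)" by (cases x, cases y)
      ultimately have s: "s \<in> extensional U" "t \<in> extensional U" "regular_on U s" "regular_on U t"
        and \<sigma>: "\<sigma> \<in> {..<d - 1} \<rightarrow>\<^sub>E taut_sections U" "\<tau> \<in> {..<d - 1} \<rightarrow>\<^sub>E taut_sections U"
        by (auto simp: carrier_regular_functions)
      have \<sigma>': "\<sigma> i \<in> taut_sections U" "\<tau> i \<in> taut_sections U" if "i < d - 1" for i using \<sigma> that by auto
      note inj = from_sum_inj[OF U s(3,4) \<sigma>' eq[unfolded xy]]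
      have "s = t" by (rule extensionalityI[OF s(1,2) inj(1)])
      moreover have "\<sigma> = \<tau>"
      proof (rule PiE_ext[OF \<sigma>])
        fix i assume i: "i \<in> {..<d - 1}"
        show "\<sigma> i = \<tau> i"
          using \<sigma>'[of i] i inj(2)[of _ i]
          by (intro extensionalityI[of _ U]) (auto simp: taut_sections_def)
      qed
      ultimately show "x = y" by (simp add: xy)
    qed
    show "from_sum U ` ?C = carrier (regular_functions (f -` U))"
    proof (intro equalityI subsetI)
      fix h assume "h \<in> carrier (regular_functions (f -` U))"
      then show "h \<in> from_sum U ` ?C"
        using from_sum_surj[OF U, of h] by (auto simp: carrier_regular_functions)
    next
      fix h assume "h \<in> from_sum U ` ?C"
      then obtain s \<sigma> where "s \<in> carrier (regular_functions U)" "\<sigma> \<in> {..<d - 1} \<rightarrow>\<^sub>E taut_sections U"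
        "h = from_sum U (s, \<sigma>)" by auto
      then show "h \<in> carrier (regular_functions (f -` U))"
        using from_sum_regular[OF U, of s \<sigma>] by (auto simp: carrier_regular_functions from_sum_def)
    qed
  qed
  fix x assume "x \<in> ?C"
  then have x2: "snd x \<in> {..<d - 1} \<rightarrow>\<^sub>E taut_sections U" and x1: "regular_on U (fst x)"
    by (simp_all add: mem_Times_iff carrier_regular_functions)
  show "(restrict (fst x) V, \<lambda>i\<in>{..<d - 1}. restrict (snd x i) V)
      \<in> carrier (regular_functions V) \<times> ({..<d - 1} \<rightarrow>\<^sub>E taut_sections V)"
    if V: "open V" "V \<subseteq> U" for V
  proof -
    have "restrict (snd x i) V \<in> taut_sections V" if "i \<in> {..<d - 1}" for i
      by (rule taut_sections_restrict[OF PiE_mem[OF x2 that] V])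
    moreover have "regular_on V (restrict (fst x) V)"
      using regular_on_subset[OF x1 V] by (rule regular_on_cong) simp
    ultimately show ?thesis by (simp add: carrier_regular_functions)
  qed
  show "from_sum V (restrict (fst x) V, \<lambda>i\<in>{..<d - 1}. restrict (snd x i) V) = restrict (from_sum U x) (f -` V)"
    if V: "open V" "V \<subseteq> U" for V
    using V(2) by (auto simp: from_sum_def fun_eq_iff)
  show "(\<lambda>p\<in>U. a p * fst x p, \<lambda>i\<in>{..<d - 1}. \<lambda>p\<in>U. (a p * fst (snd x i p), a p * snd (snd x i p))) \<in> ?C"
    if a: "a \<in> carrier (regular_functions U)" for a
  proof -
    have a': "regular_on U a" using a by (simp add: carrier_regular_functions)
    have "regular_on U (\<lambda>p\<in>U. a p * fst x p)"
      by (rule regular_on_cong[OF regular_mult[OF a' x1]]) simp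
    then show ?thesis
      using taut_sections_mult[OF a' PiE_mem[OF x2]] by (simp add: carrier_regular_functions)
  qed
  show "from_sum U (\<lambda>p\<in>U. a p * fst x p, \<lambda>i\<in>{..<d - 1}. \<lambda>p\<in>U. (a p * fst (snd x i p), a p * snd (snd x i p))) =
      (\<lambda>p\<in>f -` U. a (f p) * from_sum U x p)"
    if a: "a \<in> carrier (regular_functions U)" for a
    by (auto simp: from_sum_def fun_eq_iff ratio_mult distrib_left sum_distrib_left mult.assoc)
  fix y assume "y \<in> ?C"
  then have y2: "snd y \<in> {..<d - 1} \<rightarrow>\<^sub>E taut_sections U" and y1: "regular_on U (fst y)"
    by (simp_all add: mem_Times_iff carrier_regular_functions)
  show "(\<lambda>p\<in>U. fst x p + fst y p, \<lambda>i\<in>{..<d - 1}. \<lambda>p\<in>U.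
      (fst (snd x i p) + fst (snd y i p), snd (snd x i p) + snd (snd y i p))) \<in> ?C"
  proof -
    have "regular_on U (\<lambda>p\<in>U. fst x p + fst y p)"
      by (rule regular_on_cong[OF regular_add[OF x1 y1]]) simp
    then show ?thesis
      using taut_sections_add[OF PiE_mem[OF x2] PiE_mem[OF y2]] by (simp add: carrier_regular_functions)
  qed
  show "from_sum U (\<lambda>p\<in>U. fst x p + fst y p, \<lambda>i\<in>{..<d - 1}. \<lambda>p\<in>U.
      (fst (snd x i p) + fst (snd y i p), snd (snd x i p) + snd (snd y i p))) =
      (\<lambda>p\<in>f -` U. from_sum U x p + from_sum U y p)"
    by (auto simp: from_sum_def fun_eq_iff ratio_add distrib_right sum.distrib)
qed

end

theorem mainTheorem1:
  fixes f :: "'k::alg_closed_field proj_line \<Rightarrow> 'k proj_line" and n :: nat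
  assumes "morphism f" and "surj f" and "has_degree f n"
  shows "direct_image f \<O> \<cong>\<^sub>O \<O> \<oplus>\<^sub>O \<O>(-1) ^\<^sub>O (n - 1)"
proof -
  obtain d P Q where PQ: "d > 0" "P \<in> forms d" "Q \<in> forms d" "no_common_zero P Q"
    and f: "\<And>v. v \<noteq> (0, 0) \<Longrightarrow> f (point v) = point (P v, Q v)"
    using morphism_homogeneous[OF assms(1,2)] by blast
  obtain G where G: "G 0 = Q" "\<And>i. i < d \<Longrightarrow> G i \<in> forms d"
    "\<And>F. F \<in> forms d \<Longrightarrow> \<exists>\<alpha> c. \<forall>v. F v = \<alpha> * P v + (\<Sum>i<d. c i * G i v)"
    "\<And>\<alpha> c i. (\<And>v. \<alpha> * P v = (\<Sum>i<d. c i * G i v)) \<Longrightarrow> i < d \<Longrightarrow> c i = 0"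
    using form_basis[OF PQ(2,3,4,1)] by blast
  interpret line_map P Q d G f
    by unfold_locales (fact PQ G f assms)+
  interpret FF: field "function_field :: ('k proj_line set \<times> ('k proj_line \<Rightarrow> 'k)) set ring"
    by (rule field_function_field)
  \<comment> \<open>Dimension over a subfield is unique, so the degree in the hypothesis is the
    degree of the forms.\<close>
  have "n = d"
    using FF.dimension_is_inj[OF subfield_pullback[OF assms(1,2)]] assms(3) field_degree
    unfolding has_degree_def by blast
  then show ?thesis using direct_image_iso by simp
qed

end
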